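(* Let $\alpha>-1$, let $f^*\in\mathcal{C}(\mathbb{T})$, and let $f$ be an $\alpha$-harmonic function in $\mathbb{D}$ with $f=f^*$ on $\mathbb{T}$ (boundary values in the distributional sense). Then for every $z\in\mathbb{D}$, $$\|D_f(z)\|\le\begin{cases}\dfrac{2(1+\alpha)\|f^*\|_\infty}{1-|z|^2}\;{}_2F_1\left(-\dfrac{\alpha}{2},-\dfrac{\alpha}{2};1;|z|^2\right), & \alpha\ge 0,\\[3mm] \dfrac{2\|f^*\|_\infty}{1-|z|^2}\;{}_2F_1\left(-\dfrac{\alpha}{2},-\dfrac{\alpha}{2};1;|z|^2\right), & -1<\alpha<0.\end{cases}$$
   Context: $\mathbb{D}$ is the open unit disk and $\mathbb{T}$ the unit circle in $\mathbb{C}$; functions are complex-valued; $\mathcal{C}(\mathbb{T})$ is the space of continuous functions on $\mathbb{T}$. For $\alpha>-1$ the weighted Laplace operator is $\Delta_\alpha=\partial_z(1-|z|^2)^{-\alpha}\overline{\partial}_z$, i.e. $\Delta_\alpha f=\partial_z\big((1-|z|^2)^{-\alpha}\,\overline{\partial}_z f\big)$, where $\partial_z=\frac12(\partial_x-i\partial_y)$ and $\overline{\partial}_z=\frac12(\partial_x+i\partial_y)$. A function $f\in\mathcal{C}^2(\mathbb{D})$ is $\alpha$-harmonic if $\Delta_\alpha f=0$ in $\mathbb{D}$. The boundary condition $f=f^*$ on $\mathbb{T}$ means that $f(re^{i\theta})\to f^*(e^{i\theta})$ in the space of distributions $\mathcal{D}'(\mathbb{T})$ as $r\to1^-$. $\|f^*\|_\infty=\operatorname{ess\,sup}_{z\in\mathbb{T}}|f^*(z)|$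 and $\|D_f(z)\|=|f_z(z)|+|f_{\bar z}(z)|$, where $f_z=\partial_z f$, $f_{\bar z}=\overline{\partial}_z f$. The hypergeometric function is ${}_2F_1(a,b;c;x)=\sum_{n=0}^\infty\frac{(a)_n(b)_n}{(c)_n\,n!}x^n$ for $|x|<1$, where $(a)_0=1$ and $(a)_n=a(a+1)\cdots(a+n-1)$. *)

theory Defs
  imports "HOL-Analysis.Analysis" "HOL-Probability.Essential_Supremum"
begin

text \<open>
  Differentiability of \<open>f :: complex \<Rightarrow> complex\<close> is real differentiability throughout, so that the
  real derivative in the directions \<open>1\<close> and \<open>\<i>\<close> gives the partial derivatives in \<open>x\<close> and \<open>y\<close>.
\<close>

definition partial_x :: "(complex \<Rightarrow> complex) \<Rightarrow> complex \<Rightarrow> complex" where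
  "partial_x f z = frechet_derivative f (at z) 1"

definition partial_y :: "(complex \<Rightarrow> complex) \<Rightarrow> complex \<Rightarrow> complex" where
  "partial_y f z = frechet_derivative f (at z) \<i>"

definition d_z :: "(complex \<Rightarrow> complex) \<Rightarrow> complex \<Rightarrow> complex" where
  "d_z f z = (partial_x f z - \<i> * partial_y f z) / 2"

definition d_zbar :: "(complex \<Rightarrow> complex) \<Rightarrow> complex \<Rightarrow> complex" where
  "d_zbar f z = (partial_x f z + \<i> * partial_y f z) / 2"

text \<open>\<open>C_on k S f\<close> says that \<open>f\<close> is of class \<open>C\<^sup>k\<close> on \<open>S\<close>; it is meant for open \<open>S\<close>.\<close>

primrec C_on :: "nat \<Rightarrow> complex set \<Rightarrow> (complex \<Rightarrow> complex) \<Rightarrow> bool" where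
  "C_on 0 S f \<longleftrightarrow> continuous_on S f"
| "C_on (Suc k) S f \<longleftrightarrow>
     (\<forall>z\<in>S. f differentiable (at z)) \<and> C_on k S (partial_x f) \<and> C_on k S (partial_y f)"

definition weighted_laplacian :: "real \<Rightarrow> (complex \<Rightarrow> complex) \<Rightarrow> complex \<Rightarrow> complex" where
  "weighted_laplacian \<alpha> f =
     d_z (\<lambda>w. of_real ((1 - (cmod w)\<^sup>2) powr (- \<alpha>)) * d_zbar f w)"

definition alpha_harmonic :: "real \<Rightarrow> (complex \<Rightarrow> complex) \<Rightarrow> bool" where
  "alpha_harmonic \<alpha> f \<longleftrightarrow>
     C_on 2 (ball 0 1) f \<and> (\<forall>z\<in>ball 0 1. weighted_laplacian \<alpha> f z = 0)"

text \<open>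
  Test functions on the unit circle: \<open>\<phi>\<close> is smooth on the circle iff \<open>\<theta> \<mapsto> \<phi> (e\<^sup>i\<^sup>\<theta>)\<close> has
  derivatives of all orders on the real line.
\<close>

definition circle_test_function :: "(complex \<Rightarrow> complex) \<Rightarrow> bool" where
  "circle_test_function \<phi> \<longleftrightarrow>
     (\<forall>k \<theta>. ((\<lambda>g t. vector_derivative g (at t)) ^^ k) (\<lambda>t::real. \<phi> (cis t))
              differentiable (at \<theta>))"

text \<open>The distribution on the circle induced by a continuous function.\<close>

definition circle_distribution :: "(complex \<Rightarrow> complex) \<Rightarrow> (complex \<Rightarrow> complex) \<Rightarrow> complex" where
  "circle_distribution u \<phi> = integral {0..2 * pi} (\<lambda>\<theta>. u (cis \<theta>) * \<phi> (cis \<theta>))"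

definition distributional_boundary_values ::
    "(complex \<Rightarrow> complex) \<Rightarrow> (complex \<Rightarrow> complex) \<Rightarrow> bool" where
  "distributional_boundary_values f fstar \<longleftrightarrow>
     (\<forall>\<phi>. circle_test_function \<phi> \<longrightarrow>
        ((\<lambda>r::real. circle_distribution (\<lambda>\<zeta>. f (of_real r * \<zeta>)) \<phi>)
           \<longlongrightarrow> circle_distribution fstar \<phi>) (at_left 1))"

text \<open>
  The essential supremum is that of the library, which takes extended real values; the conversion
  back to \<open>real\<close> is harmless for essentially bounded functions.
\<close>

definition circle_norm_inf :: "(complex \<Rightarrow> complex) \<Rightarrow> real" where
  "circle_norm_inf u =
     real_of_ereal (esssup (lebesgue_on {0..2 * pi}) (\<lambda>\<theta>. ereal (cmod (u (cis \<theta>)))))"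

definition D_norm :: "(complex \<Rightarrow> complex) \<Rightarrow> complex \<Rightarrow> real" where
  "D_norm f z = cmod (d_z f z) + cmod (d_zbar f z)"

definition hypergeom_2F1 :: "real \<Rightarrow> real \<Rightarrow> real \<Rightarrow> real \<Rightarrow> real" where
  "hypergeom_2F1 a b c x =
     (\<Sum>n. pochhammer a n * pochhammer b n / (pochhammer c n * fact n) * x ^ n)"

end

theory Submission
  imports Defs "HOL-Complex_Analysis.Complex_Analysis"
begin

text \<open>
  The equation says that \<open>d_zbar f\<close> is \<open>(1 - |z|\<^sup>2)\<^sup>\<alpha>\<close> times an antiholomorphic function. The Taylor
  coefficients of the latter are determined by the boundary values: \<open>r\<^sup>n\<^sup>+\<^sup>1\<close> times the Fourier coefficient
  of \<open>t \<mapsto> f (r e\<^sup>i\<^sup>t)\<close> of index \<open>-(n + 1)\<close> is the \<open>n\<close>-th coefficient times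
  \<open>2 \<integral> \<rho>\<^sup>2\<^sup>n\<^sup>+\<^sup>1 (1 - \<rho>\<^sup>2)\<^sup>\<alpha> d\<rho>\<close> over \<open>[0, r]\<close>, and one lets \<open>r\<close> tend to 1. Hence \<open>f\<close> and the
  Poisson integral of the boundary function have the same \<open>d_zbar\<close>; their difference is holomorphic and
  its Fourier coefficients on the circle of radius \<open>r\<close> tend to 0, so it vanishes.

  The two derivatives of the Poisson kernel are together at most
  \<open>(2 + \<alpha> + |\<alpha>|) (1 - |z|\<^sup>2)\<^sup>\<alpha> |1 - cnj z e\<^sup>i\<^sup>t|\<^sup>-\<^sup>\<alpha>\<^sup>-\<^sup>2\<close>. The disc automorphism taking \<open>z\<close> to \<open>0\<close>
  turns the mean of this into that of \<open>|1 + cnj z e\<^sup>i\<^sup>s|\<^sup>\<alpha>\<close>, which Parseval's identity evaluates as the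
  hypergeometric series.
\<close>

section \<open>Wirtinger derivatives\<close>

text \<open>Every real-linear map of the plane has the form \<open>A * h + B * cnj h\<close>.
  Derivatives are carried in this form throughout, so that the ordinary differentiation rules apply
  and both Wirtinger derivatives can be read off at the end.\<close>

lemma wirtinger_has_derivative:
  assumes "f differentiable (at z)"
  shows "(f has_derivative (\<lambda>h. d_z f z * h + d_zbar f z * cnj h)) (at z)"
proof -
  let ?D = "frechet_derivative f (at z)"
  have D: "(f has_derivative ?D) (at z)"
    using assms frechet_derivative_works by blast
  interpret linear ?D
    using D has_derivative_linear by blast
  have "?D h = d_z f z * h + d_zbar f z * cnj h" for h
  proof -
    have "?D h = ?D (Re h *\<^sub>R 1 + Im h *\<^sub>R \<i>)"
      by (rule arg_cong[where f = ?D]) (simp add: complex_eq_iff)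
    also have "\<dots> = Re h * ?D 1 + Im h * ?D \<i>"
      by (simp only: add scale) (simp add: scaleR_conv_of_real)
    also have "\<dots> = (?D 1 - \<i> * ?D \<i>) / 2 * h + (?D 1 + \<i> * ?D \<i>) / 2 * cnj h"
      by (simp add: complex_eq_iff field_simps)
    finally show ?thesis
      by (simp add: d_z_def d_zbar_def partial_x_def partial_y_def)
  qed
  with D show ?thesis by (metis (no_types, lifting) ext)
qed

lemma wirtinger_eqI:
  assumes "(f has_derivative (\<lambda>h. A * h + B * cnj h)) (at z)"
  shows "d_z f z = A" "d_zbar f z = B"
proof -
  have "frechet_derivative f (at z) = (\<lambda>h. A * h + B * cnj h)"
    using assms frechet_derivative_at by metis
  then show "d_z f z = A" "d_zbar f z = B"
    by (simp_all add: d_z_def d_zbar_def partial_x_def partial_y_def algebra_simps)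
qed

text \<open>Transfers derivatives from the Poisson integral to \<open>f\<close>: the two are known
  to agree only inside the disc.\<close>

lemma wirtinger_cong:
  assumes "open S" "z \<in> S" "\<And>w. w \<in> S \<Longrightarrow> f w = g w" "g differentiable (at z)"
  shows "d_z f z = d_z g z" "d_zbar f z = d_zbar g z"
proof -
  have "(f has_derivative (\<lambda>h. d_z g z * h + d_zbar g z * cnj h)) (at z)"
    using has_derivative_transform_within_open[OF wirtinger_has_derivative[OF assms(4)] assms(1,2)] assms(3)
    by metis
  then show "d_z f z = d_z g z" "d_zbar f z = d_zbar g z"
    by (rule wirtinger_eqI)+
qed

text \<open>With \<open>d_z f z = 0\<close> the derivative of \<open>f\<close> is
  \<open>d_zbar f z * cnj h\<close>; conjugation makes it complex linear.\<close>

lemma cnj_holomorphic_on_if_d_z_zero: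
  assumes "open S" "\<And>z. z \<in> S \<Longrightarrow> f differentiable (at z)" "\<And>z. z \<in> S \<Longrightarrow> d_z f z = 0"
  shows "(\<lambda>z. cnj (f z)) holomorphic_on S"
proof -
  have "((\<lambda>z. cnj (f z)) has_field_derivative cnj (d_zbar f z)) (at z)" if "z \<in> S" for z
    using has_derivative_cnj[OF wirtinger_has_derivative[OF assms(2)[OF that]]] assms(3)[OF that]
    by (simp add: has_field_derivative_def)
  then show ?thesis
    using \<open>open S\<close> holomorphic_on_open by blast
qed

section \<open>The weight, and differentiation under the integral sign\<close>

lemma one_minus_cmod2_pos: "z \<in> ball 0 1 \<Longrightarrow> 0 < 1 - (cmod z)\<^sup>2"
  by (simp add: abs_square_less_1)

lemma has_derivative_weight:
  assumes "z \<in> ball 0 1"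
  shows "((\<lambda>w. complex_of_real ((1 - (cmod w)\<^sup>2) powr \<beta>)) has_derivative
    (\<lambda>h. of_real (- \<beta> * (1 - (cmod z)\<^sup>2) powr (\<beta> - 1)) * (cnj z * h + z * cnj h))) (at z)"
proof -
  note pos = one_minus_cmod2_pos[OF assms]
  \<comment> \<open>Expanding the squared modulus in \<open>Re\<close> and \<open>Im\<close> covers
    the point 0, where \<open>cmod\<close> itself is not differentiable. The bracket
    \<open>2 * (Re z * Re h + Im z * Im h)\<close> equals
    \<open>cnj z * h + z * cnj h\<close>.\<close>
  have "((\<lambda>w. 1 - (cmod w)\<^sup>2) has_derivative (\<lambda>h. - (2 * (Re z * Re h + Im z * Im h)))) (at z)"
    unfolding cmod_power2
    by (auto intro!: derivative_eq_intros bounded_linear_Re bounded_linear_Im simp: algebra_simps)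
  then have "((\<lambda>w. complex_of_real ((1 - (cmod w)\<^sup>2) powr \<beta>)) has_derivative
    (\<lambda>h. of_real (\<beta> * (1 - (cmod z)\<^sup>2) powr (\<beta> - 1) * - (2 * (Re z * Re h + Im z * Im h))))) (at z)"
    by (rule has_derivative_of_real[OF has_derivative_eq_rhs[OF has_derivative_powr[OF _ has_derivative_const]]])
      (use pos in \<open>auto simp: powr_diff field_simps\<close>)
  moreover have "of_real (\<beta> * (1 - (cmod z)\<^sup>2) powr (\<beta> - 1) * - (2 * (Re z * Re h + Im z * Im h)))
    = complex_of_real (- \<beta> * (1 - (cmod z)\<^sup>2) powr (\<beta> - 1)) * (cnj z * h + z * cnj h)" for h
    by (simp add: complex_eq_iff algebra_simps)
  ultimately show ?thesis by (simp only:)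
qed

lemma wirtinger_leibniz:
  fixes F :: "complex \<Rightarrow> real \<Rightarrow> complex"
  assumes U: "open U" "convex U" "z0 \<in> U"
    and deriv: "\<And>z t. z \<in> U \<Longrightarrow> t \<in> {a..b} \<Longrightarrow>
      ((\<lambda>z. F z t) has_derivative (\<lambda>h. A z t * h + B z t * cnj h)) (at z)"
    and F: "\<And>z. z \<in> U \<Longrightarrow> continuous_on {a..b} (F z)"
    and A: "continuous_on (U \<times> {a..b}) (\<lambda>(z, t). A z t)"
    and B: "continuous_on (U \<times> {a..b}) (\<lambda>(z, t). B z t)"
  shows "((\<lambda>z. integral {a..b} (F z)) has_derivative
    (\<lambda>h. integral {a..b} (A z0) * h + integral {a..b} (B z0) * cnj h)) (at z0)"
proof -
  define C where "C = Blinfun cnj"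
  have C: "blinfun_apply C = cnj"
    unfolding C_def by (rule bounded_linear_Blinfun_apply) (rule bounded_linear_cnj)
  \<comment> \<open>\<open>leibniz_rule\<close> takes the derivative as a continuous map into the
    bounded linear maps, so the pair \<open>A\<close>, \<open>B\<close> is packed into one such map.
    Evaluating its integral at \<open>h\<close> unpacks it again.\<close>
  define D where "D z t = blinfun_mult_right (A z t) + (blinfun_mult_right (B z t) o\<^sub>L C)" for z t
  have D: "blinfun_apply (D z t) = (\<lambda>h. A z t * h + B z t * cnj h)" for z t
    by (auto simp: D_def C blinfun.add_left fun_eq_iff)
  have contD: "continuous_on (U \<times> cbox a b) (\<lambda>(z, t). D z t)"
    unfolding D_def using A B by (auto simp: split_beta intro!: continuous_intros)
  have sec: "continuous_on {a..b} (\<lambda>t. G z0 t)" 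
    if "continuous_on (U \<times> {a..b}) (\<lambda>(z, t). G z t)" for G :: "complex \<Rightarrow> real \<Rightarrow> complex"
  proof -
    have "continuous_on {a..b} (\<lambda>t. (z0, t))" by (intro continuous_intros)
    from continuous_on_compose2[OF that this] show ?thesis using U by auto
  qed
  have sD: "continuous_on {a..b} (D z0)"
    unfolding D_def using sec[OF A] sec[OF B] by (auto intro!: continuous_intros)
  have "((\<lambda>z. integral (cbox a b) (F z)) has_derivative integral (cbox a b) (D z0)) (at z0 within U)"
  proof (rule leibniz_rule[OF _ _ contD U(3,2)])
    fix z t assume "z \<in> U" "t \<in> cbox a b"
    then show "((\<lambda>z. F z t) has_derivative blinfun_apply (D z t)) (at z within U)"
      unfolding D using has_derivative_at_withinI[OF deriv[of z t]] by simp
  next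
    fix z assume "z \<in> U" then show "F z integrable_on cbox a b"
      using F by (auto intro: integrable_continuous_real)
  qed
  moreover have "blinfun_apply (integral (cbox a b) (D z0)) =
    (\<lambda>h. integral {a..b} (A z0) * h + integral {a..b} (B z0) * cnj h)"
  proof
    fix h
    have "blinfun_apply (integral (cbox a b) (D z0)) h = integral {a..b} (\<lambda>t. D z0 t h)"
      using integral_linear[OF integrable_continuous_real[OF sD] blinfun.bounded_linear_left[of h]]
      by (simp add: o_def)
    also have "\<dots> = integral {a..b} (\<lambda>t. A z0 t * h) + integral {a..b} (\<lambda>t. B z0 t * cnj h)"
      unfolding D using sec[OF A] sec[OF B]
      by (intro Henstock_Kurzweil_Integration.integral_add integrable_continuous_real continuous_intros)
    finally show "blinfun_apply (integral (cbox a b) (D z0)) h =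
      integral {a..b} (A z0) * h + integral {a..b} (B z0) * cnj h"
      by simp
  qed
  ultimately show ?thesis
    using U at_within_open[OF U(3,1)] by simp
qed

section \<open>Fourier coefficients of power series and a hypergeometric integral\<close>

lemma integral_sums:
  fixes g :: "nat \<Rightarrow> real \<Rightarrow> complex"
  assumes cont: "\<And>n. continuous_on {a..b} (g n)"
    and bound: "\<And>n t. t \<in> {a..b} \<Longrightarrow> norm (g n t) \<le> M n"
    and M: "summable M"
    and S: "\<And>t. t \<in> {a..b} \<Longrightarrow> (\<lambda>n. g n t) sums S t"
  shows "(\<lambda>n. integral {a..b} (g n)) sums integral {a..b} S"
proof -
  have "uniform_limit {a..b} (\<lambda>n t. \<Sum>k<n. g k t) (\<lambda>t. \<Sum>k. g k t) sequentially"
    by (rule Weierstrass_m_test[OF _ M]) (use bound in auto)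
  then have "uniform_limit {a..b} (\<lambda>n t. \<Sum>k<n. g k t) S sequentially"
    using S by (subst uniform_limit_cong'[where i = "\<lambda>t. \<Sum>k. g k t"]) (auto simp: sums_iff)
  then obtain I J where I: "\<And>n. ((\<lambda>t. \<Sum>k<n. g k t) has_integral I n) {a..b}"
      and J: "(S has_integral J) {a..b}" and IJ: "I \<longlonglongrightarrow> J"
    by (rule uniform_limit_integral)
      (auto intro!: continuous_intros cont)
  have "I = (\<lambda>n. \<Sum>k<n. integral {a..b} (g k))"
    using integral_unique[OF I] by (simp add: integral_sum integrable_continuous_real cont fun_eq_iff)
  then show ?thesis
    using IJ integral_unique[OF J] by (simp add: sums_def)
qed

lemma has_vector_derivative_cis:
  "((\<lambda>t. cis (k * t)) has_vector_derivative \<i> * of_real k * cis (k * t)) (at t within S)"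
proof -
  have "((\<lambda>z. exp (\<i> * of_real k * z)) has_field_derivative
      \<i> * of_real k * exp (\<i> * of_real k * of_real t)) (at (of_real t))"
    by (auto intro!: derivative_eq_intros)
  from has_vector_derivative_real_field[OF this] show ?thesis
    by (simp add: cis_conv_exp mult_ac)
qed

text \<open>The period starts at an arbitrary \<open>s\<close> because a later substitution maps
  \<open>[0, 2 \<pi>]\<close> onto a shifted period.\<close>

lemma integral_cis:
  "integral {s..s + 2 * pi} (\<lambda>t. cis (of_int m * t)) = (if m = 0 then 2 * pi else 0)"
proof (cases "m = 0")
  case False
  let ?F = "\<lambda>t. cis (of_int m * t) / (\<i> * of_int m)"
  have "((\<lambda>t. cis (of_int m * t)) has_integral (?F (s + 2 * pi) - ?F s)) {s..s + 2 * pi}"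
    using False
    by (intro fundamental_theorem_of_calculus
        has_vector_derivative_divide[OF has_vector_derivative_cis, THEN has_vector_derivative_eq_rhs]) auto
  moreover have "cis (of_int m * (s + 2 * pi)) = cis (of_int m * s)"
    using cis_multiple_2pi[of "of_int m"] by (simp add: distrib_left mult_ac flip: cis_mult)
  ultimately show ?thesis using False by (simp add: integral_unique)
qed (simp add: scaleR_conv_of_real)

text \<open>Convergence at a real point \<open>r\<close> with \<open>|c| < r < 1\<close> forces
  absolute convergence at \<open>c\<close>.\<close>

lemma summable_norm_power_series:
  fixes g :: "nat \<Rightarrow> complex"
  assumes "\<And>w. w \<in> ball 0 1 \<Longrightarrow> (\<lambda>n. g n * w ^ n) sums G w" and "cmod c < 1"
  shows "summable (\<lambda>n. norm (g n) * norm c ^ n)"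
proof -
  obtain r where r: "cmod c < r" "r < 1"
    using \<open>cmod c < 1\<close> dense by blast
  have "0 < r" using r norm_ge_zero[of c] by linarith
  then have "summable (\<lambda>n. g n * of_real r ^ n)"
    using assms(1)[of "of_real r"] r by (auto simp: sums_iff)
  from powser_insidea[OF this, of c] show ?thesis
    using r \<open>0 < r\<close> by (simp add: norm_mult norm_power)
qed

text \<open>Termwise integration on a circle inside the disc: the M-test majorant is
  \<open>|g n| * |c| ^ n\<close> times a bound for \<open>h\<close>.\<close>

lemma integral_power_series:
  fixes g :: "nat \<Rightarrow> complex"
  assumes G: "\<And>w. w \<in> ball 0 1 \<Longrightarrow> (\<lambda>n. g n * w ^ n) sums G w" and c: "cmod c < 1"
    and h: "continuous_on {a..b} h"
  shows "(\<lambda>n. g n * c ^ n * integral {a..b} (\<lambda>t. cis (of_nat n * t) * h t)) sums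
    integral {a..b} (\<lambda>t. G (c * cis t) * h t)"
proof -
  have "bounded (h ` {a..b})"
    using h compact_continuous_image compact_imp_bounded compact_Icc by blast
  then obtain B where B: "\<And>t. t \<in> {a..b} \<Longrightarrow> norm (h t) \<le> B"
    unfolding bounded_iff by blast
  have "(\<lambda>n. integral {a..b} (\<lambda>t. g n * c ^ n * (cis (of_nat n * t) * h t))) sums
    integral {a..b} (\<lambda>t. G (c * cis t) * h t)"
  proof (rule integral_sums)
    show "summable (\<lambda>n. norm (g n) * norm c ^ n * B)"
      using summable_norm_power_series[OF G c] by (rule summable_mult2)
    show "(\<lambda>n. g n * c ^ n * (cis (of_nat n * t) * h t)) sums (G (c * cis t) * h t)" for t
      using sums_mult2[OF G[of "c * cis t"], of "h t"] c
      by (simp add: norm_mult power_mult_distrib Complex.DeMoivre mult_ac)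
    show "norm (g n * c ^ n * (cis (of_nat n * t) * h t)) \<le> norm (g n) * norm c ^ n * B"
      if "t \<in> {a..b}" for n t
      using B[OF that] by (simp add: norm_mult norm_power mult_left_mono)
  qed (auto intro!: continuous_intros h)
  then show ?thesis by simp
qed

text \<open>After termwise integration, orthogonality of the characters leaves the single term of
  index \<open>k\<close>.\<close>

lemma fourier_coefficient_power_series:
  fixes g :: "nat \<Rightarrow> complex"
  assumes G: "\<And>w. w \<in> ball 0 1 \<Longrightarrow> (\<lambda>n. g n * w ^ n) sums G w" and c: "cmod c < 1"
  shows "integral {s..s + 2 * pi} (\<lambda>t. G (c * cis t) * cis (- (of_nat k * t))) = 2 * pi * g k * c ^ k"
proof -
  have "(\<lambda>n. g n * c ^ n * integral {s..s + 2 * pi} (\<lambda>t. cis (of_nat n * t) * cis (- (of_nat k * t)))) sums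
    integral {s..s + 2 * pi} (\<lambda>t. G (c * cis t) * cis (- (of_nat k * t)))"
    by (rule integral_power_series[OF G c]) (auto intro!: continuous_intros)
  moreover have "integral {s..s + 2 * pi} (\<lambda>t. cis (of_nat n * t) * cis (- (of_nat k * t))) =
    (if n = k then 2 * pi else 0)" for n
    using integral_cis[of s "int n - int k"] by (simp add: cis_mult left_diff_distrib)
  ultimately have "(\<lambda>n. if n = k then 2 * pi * g k * c ^ k else 0) sums
    integral {s..s + 2 * pi} (\<lambda>t. G (c * cis t) * cis (- (of_nat k * t)))"
    by (elim sums_cong[THEN iffD1, rotated]) auto
  moreover have "(\<lambda>n. if n = k then 2 * pi * g k * c ^ k else 0) sums (2 * pi * g k * c ^ k)"
    using sums_single[of k "\<lambda>_. 2 * pi * g k * c ^ k"] by simp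
  ultimately show ?thesis using sums_unique2 by blast
qed

section \<open>The binomial series and circular means of powers\<close>

lemma binomial_series:
  fixes \<beta> w :: complex
  assumes "w \<in> ball 0 1"
  shows "(\<lambda>n. pochhammer \<beta> n / fact n * w ^ n) sums (1 - w) powr (- \<beta>)"
proof -
  have "(\<lambda>n. ((- \<beta>) gchoose n) * (- w) ^ n) sums (1 + - w) powr (- \<beta>)"
    using assms by (intro gen_binomial_complex) simp
  moreover have "((- \<beta>) gchoose n) * (- w) ^ n = pochhammer \<beta> n / fact n * w ^ n" for n
  proof -
    have "(- 1) ^ n * (- w) ^ n = w ^ n"
      by (simp flip: power_mult_distrib)
    then show ?thesis by (simp add: gbinomial_pochhammer mult_ac)
  qed
  ultimately show ?thesis by simp
qed

text \<open>Positive real part keeps the base of all complex powers and logarithms below away from 0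
  and from the branch cut.\<close>

lemma one_minus_in_slit_plane:
  assumes "cmod w < 1"
  shows "1 - w \<notin> \<real>\<^sub>\<le>\<^sub>0" "1 - w \<noteq> 0" "0 < Re (1 - w)"
  using complex_Re_le_cmod[of w] assms by (auto simp: complex_nonpos_Reals_iff)

text \<open>With \<open>G w = (1 - w) powr (\<alpha> / 2)\<close> the integrand is
  \<open>|G (- c * cis t)|^2\<close>. Parseval gives the sum of \<open>(b n)^2 * |c|^(2 n)\<close>,
  where \<open>b n = (-\<alpha>/2)_n / n!\<close> are the binomial coefficients of
  \<open>G\<close>.\<close>

lemma integral_cmod_powr:
  assumes c: "cmod c < 1"
  shows "integral {s..s + 2 * pi} (\<lambda>t. cmod (1 + c * cis t) powr \<alpha>) =
    2 * pi * hypergeom_2F1 (- \<alpha> / 2) (- \<alpha> / 2) 1 ((cmod c)\<^sup>2)"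
proof -
  define \<beta> where "\<beta> = complex_of_real (- \<alpha> / 2)"
  define b where "b n = (pochhammer (- \<alpha> / 2) n / fact n :: real)" for n
  have b: "pochhammer \<beta> n / fact n = of_real (b n)" for n
    unfolding b_def \<beta>_def pochhammer_of_real by simp
  define G where "G w = (1 - w) powr (- \<beta>)" for w
  have G: "(\<lambda>n. of_real (b n) * w ^ n) sums G w" if "w \<in> ball 0 1" for w
    using binomial_series[OF that, of \<beta>] unfolding b G_def .
  have normG: "G w * cnj (G w) = of_real (cmod (1 - w) powr \<alpha>)" for w
  proof -
    have "G w * cnj (G w) = of_real ((cmod (G w))\<^sup>2)"
      by (metis complex_norm_square)
    also have "cmod (G w) = cmod (1 - w) powr (\<alpha> / 2)"
      by (simp add: G_def \<beta>_def norm_powr_real_powr')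
    also have "\<dots>\<^sup>2 = cmod (1 - w) powr \<alpha>"
      by (simp add: power2_eq_square flip: powr_add)
    finally show ?thesis .
  qed
  have ne: "1 + c * cis t \<noteq> 0" for t
    using one_minus_in_slit_plane(2)[of "- c * cis t"] c by (simp add: norm_mult)
  have contG: "continuous_on {s..s + 2 * pi} (\<lambda>t. G (- c * cis t))"
    unfolding G_def
    using one_minus_in_slit_plane(2,3)[of "- c * cis t" for t] c
    by (intro continuous_intros) (auto simp: norm_mult less_imp_le)
  let ?I = "integral {s..s + 2 * pi}"
  have cnj_coeff: "?I (\<lambda>t. cis (of_nat n * t) * cnj (G (- c * cis t))) = 2 * pi * of_real (b n) * cnj (- c) ^ n" for n
  proof -
    have "?I (\<lambda>t. cis (of_nat n * t) * cnj (G (- c * cis t))) =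
      cnj (?I (\<lambda>t. G (- c * cis t) * cis (- (of_nat n * t))))"
      by (simp add: Henstock_Kurzweil_Integration.integral_cnj cis_cnj mult.commute)
    also have "\<dots> = cnj (2 * pi * of_real (b n) * (- c) ^ n)"
      using c by (subst fourier_coefficient_power_series[OF G]) auto
    finally show ?thesis by simp
  qed
  \<comment> \<open>Only one of the two factors is expanded; the integrals against the other are its
    conjugated Fourier coefficients, found in \<open>cnj_coeff\<close>.\<close>
  have "(\<lambda>n. of_real (b n) * (- c) ^ n * ?I (\<lambda>t. cis (of_nat n * t) * cnj (G (- c * cis t)))) sums
      ?I (\<lambda>t. G (- c * cis t) * cnj (G (- c * cis t)))"
    by (rule integral_power_series[OF G]) (use c contG in \<open>auto intro!: continuous_intros\<close>)
  moreover have "of_real (b n) * (- c) ^ n * (2 * pi * of_real (b n) * cnj (- c) ^ n) =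
      complex_of_real (2 * pi * ((b n)\<^sup>2 * ((cmod c)\<^sup>2) ^ n))" for n
  proof -
    have "(- c) ^ n * cnj (- c) ^ n = of_real (((cmod c)\<^sup>2) ^ n)"
      by (metis complex_norm_square norm_minus_cancel of_real_power power_mult_distrib)
    then show ?thesis by (simp add: power2_eq_square mult_ac)
  qed
  moreover have "?I (\<lambda>t. G (- c * cis t) * cnj (G (- c * cis t))) =
      of_real (?I (\<lambda>t. cmod (1 + c * cis t) powr \<alpha>))"
    unfolding normG
    by (subst integral_unique[OF has_integral_of_real[OF integrable_integral]])
      (use ne in \<open>auto intro!: integrable_continuous_real continuous_intros\<close>)
  ultimately have "(\<lambda>n. complex_of_real (2 * pi * ((b n)\<^sup>2 * ((cmod c)\<^sup>2) ^ n))) sums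
      of_real (?I (\<lambda>t. cmod (1 + c * cis t) powr \<alpha>))"
    unfolding cnj_coeff by (simp only:)
  then have "(\<lambda>n. 2 * pi * ((b n)\<^sup>2 * ((cmod c)\<^sup>2) ^ n)) sums ?I (\<lambda>t. cmod (1 + c * cis t) powr \<alpha>)"
    by (simp only: sums_of_real_iff)
  then have "?I (\<lambda>t. cmod (1 + c * cis t) powr \<alpha>) = (\<Sum>n. 2 * pi * ((b n)\<^sup>2 * ((cmod c)\<^sup>2) ^ n))"
    and "summable (\<lambda>n. 2 * pi * ((b n)\<^sup>2 * ((cmod c)\<^sup>2) ^ n))"
    by (simp_all add: sums_iff)
  \<comment> \<open>Since \<open>(1)_n = n!\<close>, the hypergeometric denominators are
    \<open>(n!)^2\<close>, matching \<open>(b n)^2\<close>.\<close>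
  moreover have "hypergeom_2F1 (- \<alpha> / 2) (- \<alpha> / 2) 1 ((cmod c)\<^sup>2) = (\<Sum>n. (b n)\<^sup>2 * ((cmod c)\<^sup>2) ^ n)"
    by (simp add: hypergeom_2F1_def b_def power2_eq_square flip: pochhammer_fact)
  ultimately show ?thesis
    by (simp add: suminf_mult)
qed

text \<open>Put \<open>x = 1 - |c|^2\<close> and \<open>v t = 1 - c * cis t\<close>. The
  substitution \<open>s = \<sigma> t\<close> has Jacobian \<open>x / |v t|^2\<close> and satisfies
  \<open>|1 + c * cis s| = x / |v t|\<close>. Hence \<open>|1 + c * cis s| powr \<alpha>\<close>
  times the Jacobian is exactly the integrand here.\<close>

lemma integral_weight_cmod_powr:
  assumes c: "cmod c < 1"
  shows "((\<lambda>t. (1 - (cmod c)\<^sup>2) powr (\<alpha> + 1) * cmod (1 - c * cis t) powr (- \<alpha> - 2)) has_integral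
    2 * pi * hypergeom_2F1 (- \<alpha> / 2) (- \<alpha> / 2) 1 ((cmod c)\<^sup>2)) {0..2 * pi}"
proof -
  define v where "v t = 1 - c * cis t" for t
  define x where "x = 1 - (cmod c)\<^sup>2"
  have x: "x > 0" using c by (simp add: x_def abs_square_less_1)
  have v: "v t \<notin> \<real>\<^sub>\<le>\<^sub>0" "v t \<noteq> 0" for t
    using one_minus_in_slit_plane[of "c * cis t"] c by (simp_all add: v_def norm_mult)
  \<comment> \<open>\<open>cis (\<sigma> t) = (cis t - cnj c) / (1 - c * cis t)\<close>, a disc automorphism on the circle.\<close>
  define \<sigma> where "\<sigma> t = t - 2 * Im (Ln (v t))" for t
  have \<sigma>': "(\<sigma> has_field_derivative x / (cmod (v t))\<^sup>2) (at t)" for t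
  proof -
    have "(v has_vector_derivative - (c * (\<i> * cis t))) (at t)"
      unfolding v_def using has_vector_derivative_cis[of 1 t UNIV]
      by (auto intro!: derivative_eq_intros)
    then have "((\<lambda>t. Ln (v t)) has_vector_derivative - (c * (\<i> * cis t)) * inverse (v t)) (at t)"
      by (rule field_vector_diff_chain_at[unfolded o_def]) (use v in \<open>auto intro!: derivative_eq_intros\<close>)
    then have "((\<lambda>t. Im (Ln (v t))) has_vector_derivative Im (- (c * (\<i> * cis t)) * inverse (v t))) (at t)"
      by (rule bounded_linear.has_vector_derivative[OF bounded_linear_Im])
    then have "(\<sigma> has_field_derivative 1 - 2 * Im (- (c * (\<i> * cis t)) * inverse (v t))) (at t)"
      unfolding \<sigma>_def by (auto intro!: derivative_eq_intros simp: has_real_derivative_iff_has_vector_derivative)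
    moreover have "1 - 2 * Im (- (c * (\<i> * cis t)) * inverse (v t)) = x / (cmod (v t))\<^sup>2"
    proof -
      define w where "w = c * cis t"
      have w: "(cmod c)\<^sup>2 = (Re w)\<^sup>2 + (Im w)\<^sup>2"
        unfolding cmod_power2[symmetric] w_def by (simp add: norm_mult)
      define d where "d = (1 - Re w)\<^sup>2 + (Im w)\<^sup>2"
      have vw: "v t = 1 - w" by (simp add: v_def w_def)
      have d: "(cmod (v t))\<^sup>2 = d" by (simp add: vw cmod_power2 d_def)
      then have "d \<noteq> 0" using v by auto
      have "- (c * (\<i> * cis t)) * inverse (v t) = (- \<i> * w) / (1 - w)"
        by (simp add: w_def vw divide_inverse)
      then have "1 - 2 * Im (- (c * (\<i> * cis t)) * inverse (v t)) =
          1 + 2 * (Re w * (1 - Re w) - (Im w)\<^sup>2) / d"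
        by (simp add: Im_divide d_def power2_eq_square)
      also have "\<dots> = x / d"
        unfolding x_def w using \<open>d \<noteq> 0\<close>
        by (simp add: field_simps) (simp add: d_def power2_eq_square algebra_simps)
      finally show ?thesis unfolding d .
    qed
    ultimately show ?thesis by simp
  qed
  have norm_\<sigma>: "cmod (1 + c * cis (\<sigma> t)) = x / cmod (v t)" for t
  proof -
    define w where "w = c * cis t"
    have vw: "v t = 1 - w" by (simp add: v_def w_def)
    \<comment> \<open>Rotating back by twice the argument of \<open>v\<close> is division by
      \<open>v / cnj v\<close>, which removes the logarithm from
      \<open>cis (\<sigma> t)\<close>.\<close>
    have "\<i> * of_real (2 * Im (Ln (v t))) = Ln (v t) - cnj (Ln (v t))"
      by (simp add: complex_eq_iff)
    then have "cis (2 * Im (Ln (v t))) = v t / cnj (v t)"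
      using v by (simp add: cis_conv_exp exp_diff flip: exp_cnj)
    then have "c * cis (\<sigma> t) = w / (v t / cnj (v t))"
      by (simp only: \<sigma>_def w_def flip: cis_divide) simp
    then have "1 + c * cis (\<sigma> t) = (v t + w * cnj (v t)) / v t"
      using v by (simp add: field_simps)
    also have "v t + w * cnj (v t) = 1 - w * cnj w"
      by (simp add: vw algebra_simps)
    also have "w * cnj w = of_real ((cmod c)\<^sup>2)"
      by (metis complex_norm_square w_def norm_mult norm_cis mult.right_neutral)
    also have "1 - complex_of_real ((cmod c)\<^sup>2) = of_real x"
      by (simp add: x_def)
    finally show ?thesis using x by (simp add: norm_divide)
  qed
  have ne: "1 + c * cis t \<noteq> 0" for t
    using one_minus_in_slit_plane(2)[of "- c * cis t"] c by (simp add: norm_mult)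
  \<comment> \<open>\<open>v\<close> is periodic and never meets the cut of \<open>Ln\<close>, so
    the argument returns to its value and \<open>\<sigma>\<close> advances by exactly one
    period.\<close>
  have ends: "\<sigma> (2 * pi) = \<sigma> 0 + 2 * pi"
    by (simp add: \<sigma>_def v_def)
  have "((\<lambda>t. (x / (cmod (v t))\<^sup>2) *\<^sub>R (cmod (1 + c * cis (\<sigma> t)) powr \<alpha>)) has_integral
      integral {\<sigma> 0..\<sigma> (2 * pi)} (\<lambda>s. cmod (1 + c * cis s) powr \<alpha>)) {0..2 * pi}"
  proof (rule has_integral_substitution)
    \<comment> \<open>The substitution rule asks for an interval containing the image on which the
      integrand is continuous. The imaginary part of \<open>Ln\<close> is at most
      \<open>\<pi>\<close> in modulus, so \<open>\<sigma>\<close> moves points by at most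
      \<open>2 \<pi>\<close>.\<close>
    show "\<sigma> ` {0..2 * pi} \<subseteq> {- (2 * pi)..4 * pi}"
    proof safe
      fix t assume "t \<in> {0..2 * pi}"
      then show "\<sigma> t \<in> {- (2 * pi)..4 * pi}"
        using mpi_less_Im_Ln[OF v(2), of t] Im_Ln_le_pi[OF v(2), of t]
        unfolding \<sigma>_def atLeastAtMost_iff by linarith
    qed
    show "(\<sigma> has_real_derivative x / (cmod (v t))\<^sup>2) (at t within {0..2 * pi})" for t
      using \<sigma>' by (rule has_field_derivative_at_within)
  qed (use ne ends in \<open>auto intro!: continuous_intros\<close>)
  moreover have "(x / (cmod (v t))\<^sup>2) *\<^sub>R (cmod (1 + c * cis (\<sigma> t)) powr \<alpha>) =
      x powr (\<alpha> + 1) * cmod (v t) powr (- \<alpha> - 2)" for t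
  proof -
    have "cmod (v t) > 0" using v by simp
    then show ?thesis
      unfolding norm_\<sigma> using x
      by (simp add: powr_divide powr_add powr_diff powr_minus powr_numeral divide_simps)
  qed
  ultimately show ?thesis
    unfolding ends integral_cmod_powr[OF c] x_def v_def by (simp only:)
qed

section \<open>Fourier coefficients of alpha-harmonic functions\<close>

text \<open>Characters are admissible test functions, so distributional convergence yields
  convergence of every Fourier coefficient. This is the only way the boundary condition is
  used.\<close>

lemma circle_test_function_if_cis:
  assumes "\<And>t. \<phi> (cis t) = cis (k * t)"
  shows "circle_test_function \<phi>"
proof -
  have "((\<lambda>g t. vector_derivative g (at t)) ^^ n) (\<lambda>t. \<phi> (cis t)) = (\<lambda>t. (\<i> * of_real k) ^ n * cis (k * t))" for n
  proof (induction n)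
    case (Suc n)
    have "vector_derivative (\<lambda>t. (\<i> * of_real k) ^ n * cis (k * t)) (at t) =
        (\<i> * of_real k) ^ n * (\<i> * of_real k * cis (k * t))" for t
      by (intro vector_derivative_at has_vector_derivative_mult_right has_vector_derivative_cis)
    then show ?case by (simp add: Suc mult_ac)
  qed (simp add: assms)
  moreover have "(\<lambda>t. (\<i> * of_real k) ^ n * cis (k * t)) differentiable (at t)" for n t
    using has_vector_derivative_mult_right[OF has_vector_derivative_cis, of "(\<i> * of_real k) ^ n" k t UNIV]
    by (auto simp: has_vector_derivative_def differentiable_def)
  ultimately show ?thesis by (simp add: circle_test_function_def)
qed

lemma alpha_harmonic_differentiable:
  assumes "alpha_harmonic \<alpha> f" "z \<in> ball 0 1"
  shows "f differentiable (at z)" "d_z f differentiable (at z)" "d_zbar f differentiable (at z)"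
proof -
  have C2: "C_on (Suc (Suc 0)) (ball 0 1) f"
    using assms(1) by (simp add: alpha_harmonic_def numeral_2_eq_2)
  then show "f differentiable (at z)"
    using assms(2) by simp
  have "partial_x f differentiable (at z)" "partial_y f differentiable (at z)"
    using C2 assms(2) by simp_all
  then obtain X Y where XY: "(partial_x f has_derivative X) (at z)" "(partial_y f has_derivative Y) (at z)"
    by (auto simp: differentiable_def)
  have "((\<lambda>w. 1 / 2 * (partial_x f w - \<i> * partial_y f w)) has_derivative (\<lambda>h. 1 / 2 * (X h - \<i> * Y h))) (at z)"
    "((\<lambda>w. 1 / 2 * (partial_x f w + \<i> * partial_y f w)) has_derivative (\<lambda>h. 1 / 2 * (X h + \<i> * Y h))) (at z)"
    by (intro derivative_intros XY)+
  then show "d_z f differentiable (at z)" "d_zbar f differentiable (at z)"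
    unfolding d_z_def[abs_def] d_zbar_def[abs_def] by (auto simp: differentiable_def)
qed

lemma alpha_harmonic_d_zbar:
  assumes "alpha_harmonic \<alpha> f"
  obtains h H where "\<And>w. w \<in> ball 0 1 \<Longrightarrow> (\<lambda>n. h n * w ^ n) sums H w"
    and "\<And>z. z \<in> ball 0 1 \<Longrightarrow> d_zbar f z = of_real ((1 - (cmod z)\<^sup>2) powr \<alpha>) * cnj (H z)"
proof -
  define u where "u w = of_real ((1 - (cmod w)\<^sup>2) powr (- \<alpha>)) * d_zbar f w" for w
  \<comment> \<open>\<open>frechet_derivative\<close> is an arbitrary choice at points of
    non-differentiability, so the equation \<open>d_z u z = 0\<close> carries information only
    together with this fact.\<close>
  have "u differentiable (at z)" if "z \<in> ball 0 1" for z
    using has_derivative_mult[OF has_derivative_weight[OF that, of "- \<alpha>"]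
        wirtinger_has_derivative[OF alpha_harmonic_differentiable(3)[OF assms that]]]
    unfolding u_def differentiable_def by blast
  moreover have "d_z u z = 0" if "z \<in> ball 0 1" for z
    using assms that by (simp add: alpha_harmonic_def weighted_laplacian_def u_def[abs_def])
  ultimately have "(\<lambda>z. cnj (u z)) holomorphic_on ball 0 1"
    by (intro cnj_holomorphic_on_if_d_z_zero) auto
  then have "(\<lambda>n. (deriv ^^ n) (\<lambda>z. cnj (u z)) 0 / fact n * w ^ n) sums cnj (u w)" if "w \<in> ball 0 1" for w
    using holomorphic_power_series[OF _ that] by simp
  moreover have "d_zbar f z = of_real ((1 - (cmod z)\<^sup>2) powr \<alpha>) * cnj (cnj (u z))" if "z \<in> ball 0 1" for z
    using one_minus_cmod2_pos[OF that] by (simp add: u_def powr_minus flip: of_real_mult)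
  ultimately show thesis by (rule that)
qed

lemma fourier_coefficient_radial_derivative:
  fixes m r :: real
  assumes f: "\<And>z. z \<in> ball 0 1 \<Longrightarrow> f differentiable (at z)"
    and dz: "continuous_on (ball 0 1) (d_z f)" and dzb: "continuous_on (ball 0 1) (d_zbar f)"
    and m: "m \<in> \<int>" and r: "\<bar>r\<bar> < 1"
  shows "\<exists>a'. ((\<lambda>r. integral {0..2 * pi} (\<lambda>t. f (of_real r * cis t) * cis (m * t))) has_vector_derivative a') (at r) \<and>
    of_real r * a' + of_real m * integral {0..2 * pi} (\<lambda>t. f (of_real r * cis t) * cis (m * t)) =
    2 * integral {0..2 * pi} (\<lambda>t. of_real r * cis (- t) * d_zbar f (of_real r * cis t) * cis (m * t))"
proof -
  define p where "p r t = complex_of_real r * cis t" for r t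
  define A where "A r t = d_z f (p r t)" for r t
  define B where "B r t = d_zbar f (p r t)" for r t
  let ?U = "{-1<..<1::real}" and ?I = "integral {0..2 * pi}"
  have p: "p r t \<in> ball 0 1" if "r \<in> ?U" for r t
    using that by (simp add: p_def norm_mult abs_less_iff)
  have contp: "continuous_on S (\<lambda>x. p (fst x) (snd x))" for S
    unfolding p_def by (intro continuous_intros)
  have contf: "continuous_on (ball 0 1) f"
    using f by (simp add: continuous_at_imp_continuous_on differentiable_imp_continuous_within)
  have cont: "continuous_on (?U \<times> cbox 0 (2 * pi)) (\<lambda>(r, t). F (p r t))"
    if "continuous_on (ball 0 1) F" for F :: "complex \<Rightarrow> complex"
    unfolding split_beta by (rule continuous_on_compose2[OF that contp]) (use p in auto)
  have cont_r: "continuous_on {0..2 * pi} (\<lambda>t. F (p r t))"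
    if "continuous_on (ball 0 1) F" "r \<in> ?U" for F :: "complex \<Rightarrow> complex" and r
    by (rule continuous_on_compose2[OF that(1)]) (use p[OF that(2)] in \<open>auto simp: p_def intro!: continuous_intros\<close>)
  have rU: "r \<in> ?U" using r by auto
  have f_r: "((\<lambda>r. f (p r t)) has_vector_derivative A r t * cis t + B r t * cis (- t)) (at r within S)"
    if "r \<in> ?U" for r t S
  proof -
    have "((\<lambda>r. p r t) has_vector_derivative cis t) (at r within S)"
      unfolding p_def by (auto intro!: derivative_eq_intros)
    from vector_derivative_diff_chain_within[OF this has_derivative_at_withinI[OF wirtinger_has_derivative[OF f[OF p[OF that]]]]]
    show ?thesis by (simp add: o_def A_def B_def cis_cnj)
  qed
  have f_t: "((\<lambda>t. f (p r t)) has_vector_derivative A r t * (p r t * \<i>) + B r t * cnj (p r t * \<i>)) (at t within S)" for t S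
  proof -
    have "((\<lambda>t. p r t) has_vector_derivative p r t * \<i>) (at t within S)"
      unfolding p_def using has_vector_derivative_cis[of 1 t S] by (auto intro!: derivative_eq_intros)
    from vector_derivative_diff_chain_within[OF this has_derivative_at_withinI[OF wirtinger_has_derivative[OF f[OF p[OF rU]]]]]
    show ?thesis by (simp add: o_def A_def B_def)
  qed
  define a where "a r = ?I (\<lambda>t. f (p r t) * cis (m * t))" for r
  define a' where "a' = ?I (\<lambda>t. (A r t * cis t + B r t * cis (- t)) * cis (m * t))"
  have "(a has_vector_derivative a') (at r within ?U)"
    unfolding a_def[abs_def] a'_def interval_cbox
  proof (rule leibniz_rule_vector_derivative)
    show "continuous_on (?U \<times> cbox 0 (2 * pi)) (\<lambda>(r, t). (A r t * cis t + B r t * cis (- t)) * cis (m * t))"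
      using cont[OF dz] cont[OF dzb] unfolding A_def B_def split_beta
      by (intro continuous_intros) auto
    show "(\<lambda>t. f (p r t) * cis (m * t)) integrable_on cbox 0 (2 * pi)" if "r \<in> ?U" for r
      using cont_r[OF contf that] by (auto intro!: integrable_continuous_real continuous_intros)
  qed (use r in \<open>auto intro!: has_vector_derivative_mult_left f_r\<close>)
  then have a': "(a has_vector_derivative a') (at r)"
    using at_within_open[OF rU] by simp
  \<comment> \<open>\<open>?P\<close> is the angular derivative of
    \<open>f (p r t) * cis (m * t)\<close>; its integral over a period vanishes because
    \<open>m\<close> is an integer.\<close>
  let ?P = "\<lambda>t. f (p r t) * (\<i> * of_real m * cis (m * t)) + (A r t * (p r t * \<i>) + B r t * cnj (p r t * \<i>)) * cis (m * t)"
  have "(?P has_integral f (p r (2 * pi)) * cis (m * (2 * pi)) - f (p r 0) * cis (m * 0)) {0..2 * pi}"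
    by (intro fundamental_theorem_of_calculus has_vector_derivative_mult f_t has_vector_derivative_cis) simp
  moreover have "cis (m * (2 * pi)) = 1"
    using cis_multiple_2pi[OF m] by (simp add: mult_ac)
  ultimately have P: "(?P has_integral 0) {0..2 * pi}"
    by (simp add: p_def)
  have int: "(\<lambda>t. F t) integrable_on {0..2 * pi}" if "continuous_on {0..2*pi} F" for F :: "real \<Rightarrow> complex"
    using that by (rule integrable_continuous_real)
  note cA = cont_r[OF dz rU, folded A_def] and cB = cont_r[OF dzb rU, folded B_def] and cf = cont_r[OF contf rU]
  have 1: "((\<lambda>t. (A r t * cis t + B r t * cis (- t)) * cis (m * t)) has_integral a') {0..2 * pi}"
    unfolding a'_def by (intro integrable_integral int continuous_intros cA cB)
  have 2: "((\<lambda>t. f (p r t) * cis (m * t)) has_integral a r) {0..2 * pi}"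
    unfolding a_def by (intro integrable_integral int continuous_intros cf)
  \<comment> \<open>Adding \<open>\<i> * ?P\<close>, whose integral is 0, cancels the terms with
    \<open>f\<close> and \<open>A\<close> and doubles the one with \<open>B\<close>.\<close>
  have "((\<lambda>t. of_real r * ((A r t * cis t + B r t * cis (- t)) * cis (m * t)) + of_real m * (f (p r t) * cis (m * t))
      - (- \<i>) * ?P t) has_integral of_real r * a' + of_real m * a r - (- \<i>) * 0) {0..2 * pi}"
    by (intro has_integral_diff has_integral_add has_integral_mult_right 1 2 P)
  moreover have "of_real r * ((A r t * cis t + B r t * cis (- t)) * cis (m * t)) + of_real m * (f (p r t) * cis (m * t))
      - (- \<i>) * ?P t = 2 * (of_real r * cis (- t) * B r t * cis (m * t))" for t
    by (simp add: p_def cis_cnj algebra_simps)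
  ultimately have "((\<lambda>t. 2 * (of_real r * cis (- t) * B r t * cis (m * t))) has_integral
      of_real r * a' + of_real m * a r) {0..2 * pi}"
    by (simp only: mult_zero_right diff_zero)
  from integral_unique[OF this]
  have "of_real r * a' + of_real m * a r = 2 * ?I (\<lambda>t. of_real r * cis (- t) * B r t * cis (m * t))"
    by (simp only: integral_mult_right)
  then show ?thesis
    using a' unfolding a_def[abs_def] B_def p_def by auto
qed

text \<open>\<open>- E 0\<close> is the integral over \<open>[0, 1]\<close>, half the Beta value
  \<open>B(n + 1, \<alpha> + 1)\<close>. Stating it through an antiderivative normalised at 1 gives
  at once the derivative for the differential equation and the two end values. The induction is
  integration by parts.\<close>

lemma beta_antiderivative:
  fixes \<alpha> :: real
  assumes "\<alpha> > -1"
  shows "\<exists>E. (\<forall>r. \<bar>r\<bar> < 1 \<longrightarrow> (E has_real_derivative r ^ (2 * n + 1) * (1 - r\<^sup>2) powr \<alpha>) (at r)) \<and>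
    (E \<longlongrightarrow> 0) (at_left 1) \<and> E 0 = - fact n / (2 * pochhammer (\<alpha> + 1) (Suc n))"
proof -
  have pos: "1 - r\<^sup>2 > 0" if "\<bar>r\<bar> < 1" for r :: real
    using that by (simp add: abs_square_less_1)
  define W where "W r = (1 - r\<^sup>2) powr (\<alpha> + 1)" for r :: real
  have w': "(W has_real_derivative - (2 * (\<alpha> + 1) * r * (1 - r\<^sup>2) powr \<alpha>)) (at r)"
    if "\<bar>r\<bar> < 1" for r
  proof -
    have "((\<lambda>r. 1 - r\<^sup>2) has_real_derivative - (2 * r)) (at r)"
      by (auto intro!: derivative_eq_intros)
    from DERIV_fun_powr[OF this pos[OF that], of "\<alpha> + 1"] show ?thesis
      unfolding W_def[abs_def] by (rule DERIV_cong) simp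
  qed
  \<comment> \<open>The base tends to 0; the exponent is positive because
    \<open>\<alpha> > -1\<close>, so the limit is 0.\<close>
  have "((\<lambda>r::real. (1 - r\<^sup>2) powr (\<alpha> + 1)) \<longlongrightarrow> (1 - 1\<^sup>2) powr (\<alpha> + 1)) (at_left 1)"
  proof (rule tendsto_powr2)
    show "\<forall>\<^sub>F r in at_left 1. 0 \<le> 1 - (r::real)\<^sup>2"
      by (rule eventually_mono[OF eventually_at_left_real[of 0 1]]) (auto simp: abs_square_le_1)
  qed (use assms in \<open>auto intro!: tendsto_eq_intros\<close>)
  then have w0: "(W \<longlongrightarrow> 0) (at_left 1)"
    by (simp add: W_def[abs_def])
  show ?thesis
  proof (induction n)
    case 0
    show ?case
    proof (intro exI[of _ "\<lambda>r. W r * (- 1 / (2 * (\<alpha> + 1)))"] conjI allI impI)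
      fix r :: real assume "\<bar>r\<bar> < 1"
      show "((\<lambda>r. W r * (- 1 / (2 * (\<alpha> + 1)))) has_real_derivative
          r ^ (2 * 0 + 1) * (1 - r\<^sup>2) powr \<alpha>) (at r)"
        by (rule DERIV_cong[OF DERIV_cmult_right[OF w'[OF \<open>\<bar>r\<bar> < 1\<close>]]]) (use assms in \<open>simp add: field_simps\<close>)
    qed (use assms tendsto_mult_right[OF w0, of "- 1 / (2 * (\<alpha> + 1))"] in \<open>auto simp: W_def field_simps\<close>)
  next
    case (Suc n)
    then obtain E where E: "\<And>r. \<bar>r\<bar> < 1 \<Longrightarrow> (E has_real_derivative r ^ (2 * n + 1) * (1 - r\<^sup>2) powr \<alpha>) (at r)"
      and E1: "(E \<longlongrightarrow> 0) (at_left 1)" and E0: "E 0 = - fact n / (2 * pochhammer (\<alpha> + 1) (Suc n))"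
      by blast
    define k where "k = \<alpha> + 2 + real n"
    have k: "k > 0" using assms by (simp add: k_def)
    \<comment> \<open>Write \<open>w = (1 - r^2) powr \<alpha>\<close>. The derivative of
      \<open>r ^ (2 n + 2) * W r\<close> is
      \<open>2 (n + 1) r ^ (2 n + 1) w - 2 k r ^ (2 n + 3) w\<close>; solving for the last power
      gives this antiderivative.\<close>
    let ?F = "\<lambda>r. (real (Suc n) * E r - r ^ (2 * n + 2) * W r / 2) / k"
    show ?case
    proof (intro exI[of _ ?F] conjI allI impI)
      fix r :: real assume r: "\<bar>r\<bar> < 1"
      have powr: "W r = (1 - r\<^sup>2) powr \<alpha> * (1 - r\<^sup>2)"
        using pos[OF r] by (simp add: W_def powr_add)
      have pow: "((\<lambda>r. r ^ (2 * n + 2)) has_real_derivative real (2 * n + 2) * r ^ (2 * n + 1)) (at r)"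
        using DERIV_pow[of "2 * n + 2" r] by simp
      note F' = DERIV_cdivide[OF DERIV_diff[OF DERIV_cmult[OF E[OF r], of "real (Suc n)"]
            DERIV_cdivide[OF DERIV_mult[OF pow w'[OF r]], of 2]], of k]
      have eq: "(real (Suc n) * (r ^ (2 * n + 1) * (1 - r\<^sup>2) powr \<alpha>) -
          (real (2 * n + 2) * r ^ (2 * n + 1) * W r +
           - (2 * (\<alpha> + 1) * r * (1 - r\<^sup>2) powr \<alpha>) * r ^ (2 * n + 2)) / 2) / k =
          r ^ (2 * Suc n + 1) * (1 - r\<^sup>2) powr \<alpha>"
        unfolding powr using k by (simp add: field_simps) (simp add: k_def power2_eq_square algebra_simps)
      show "(?F has_real_derivative r ^ (2 * Suc n + 1) * (1 - r\<^sup>2) powr \<alpha>) (at r)"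
        by (rule DERIV_cong[OF F' eq])
    next
      show "(?F \<longlongrightarrow> 0) (at_left 1)"
        using k by (auto intro!: tendsto_eq_intros E1 w0)
      have "pochhammer (\<alpha> + 1) (Suc (Suc n)) = pochhammer (\<alpha> + 1) (Suc n) * k"
        by (simp add: pochhammer_Suc[of _ "Suc n"] k_def)
      then show "?F 0 = - fact (Suc n) / (2 * pochhammer (\<alpha> + 1) (Suc (Suc n)))"
        by (simp add: E0)
    qed
  qed
qed

section \<open>Recovering \<open>d_zbar f\<close> from the boundary function\<close>

lemma tendsto_fourier_coefficient:
  fixes f fstar :: "complex \<Rightarrow> complex"
  assumes "distributional_boundary_values f fstar" "\<And>t. \<phi> (cis t) = cis (k * t)"
  shows "((\<lambda>r. integral {0..2 * pi} (\<lambda>t. f (of_real r * cis t) * cis (k * t)))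
    \<longlongrightarrow> integral {0..2 * pi} (\<lambda>t. fstar (cis t) * cis (k * t))) (at_left 1)"
  using assms(1)[unfolded distributional_boundary_values_def, rule_format, OF circle_test_function_if_cis[OF assms(2)]]
  unfolding circle_distribution_def assms(2) .

lemma continuous_on_circle:
  fixes fstar :: "complex \<Rightarrow> complex"
  assumes "continuous_on (sphere 0 1) fstar"
  shows "continuous_on S (\<lambda>t. fstar (cis t))"
  by (rule continuous_on_compose2[OF assms]) (auto intro!: continuous_intros)

text \<open>The radial equation gives the derivative of \<open>r ^ (n + 1) * a r\<close> as
  \<open>4 \<pi> cnj (h n)\<close> times that of \<open>E\<close>, so the difference
  \<open>F\<close> is constant on \<open>(-1, 1)\<close>. Its limit at 1 is the Fourier coefficient
  of \<open>fstar\<close>, since \<open>E\<close> tends to 0 there; its value at 0 contains only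
  \<open>h n\<close> and \<open>E 0\<close>.\<close>

lemma alpha_harmonic_negative_coefficient:
  fixes f fstar :: "complex \<Rightarrow> complex"
  assumes \<alpha>: "\<alpha> > -1" and f: "alpha_harmonic \<alpha> f" and bv: "distributional_boundary_values f fstar"
    and H: "\<And>w. w \<in> ball 0 1 \<Longrightarrow> (\<lambda>n. h n * w ^ n) sums H w"
    and fH: "\<And>z. z \<in> ball 0 1 \<Longrightarrow> d_zbar f z = of_real ((1 - (cmod z)\<^sup>2) powr \<alpha>) * cnj (H z)"
  shows "2 * pi * cnj (h n) = of_real (pochhammer (\<alpha> + 1) (Suc n) / fact n) *
    integral {0..2 * pi} (\<lambda>t. fstar (cis t) * cis (real (Suc n) * t))"
proof -
  let ?I = "integral {0..2 * pi}" and ?m = "real (Suc n)"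
  define a where "a r = ?I (\<lambda>t. f (of_real r * cis t) * cis (?m * t))" for r :: real
  obtain E where E': "\<And>r. \<bar>r\<bar> < 1 \<Longrightarrow> (E has_real_derivative r ^ (2 * n + 1) * (1 - r\<^sup>2) powr \<alpha>) (at r)"
    and E1: "(E \<longlongrightarrow> 0) (at_left 1)" and E0: "E 0 = - fact n / (2 * pochhammer (\<alpha> + 1) (Suc n))"
    using beta_antiderivative[OF \<alpha>, of n] by blast
  have contd: "continuous_on (ball 0 1) (d_z f)" "continuous_on (ball 0 1) (d_zbar f)"
    using alpha_harmonic_differentiable[OF f]
    by (auto intro!: continuous_at_imp_continuous_on differentiable_imp_continuous_within)
  define F where "F r = of_real (r ^ Suc n) * a r - 4 * pi * cnj (h n) * of_real (E r)" for r
  have F': "(F has_vector_derivative 0) (at r)" if r: "\<bar>r\<bar> < 1" for r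
  proof -
    obtain a' where a': "(a has_vector_derivative a') (at r)"
      and ode: "of_real r * a' + of_real ?m * a r =
        2 * ?I (\<lambda>t. of_real r * cis (- t) * d_zbar f (of_real r * cis t) * cis (?m * t))"
      using fourier_coefficient_radial_derivative[OF alpha_harmonic_differentiable(1)[OF f] contd _ r, of ?m]
      unfolding a_def[abs_def] by auto
    \<comment> \<open>The weight is constant on the circle and comes out of the integral; what
      remains is the conjugate of the \<open>n\<close>-th Fourier coefficient of \<open>H\<close>.
      The factor \<open>cis (- t)\<close> lowers the frequency from \<open>n + 1\<close> to
      \<open>n\<close>.\<close>
    have "?I (\<lambda>t. of_real r * cis (- t) * d_zbar f (of_real r * cis t) * cis (?m * t)) =
      ?I (\<lambda>t. of_real (r * (1 - r\<^sup>2) powr \<alpha>) * cnj (H (of_real r * cis t) * cis (- (of_nat n * t))))"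
    proof (rule integral_cong)
      fix t
      have "d_zbar f (of_real r * cis t) = of_real ((1 - r\<^sup>2) powr \<alpha>) * cnj (H (of_real r * cis t))"
        using fH[of "of_real r * cis t"] r by (simp add: norm_mult)
      moreover have "cis (- t) * cis (?m * t) = cnj (cis (- (of_nat n * t)))"
        by (simp add: cis_mult cis_cnj algebra_simps)
      ultimately show "of_real r * cis (- t) * d_zbar f (of_real r * cis t) * cis (?m * t) =
          of_real (r * (1 - r\<^sup>2) powr \<alpha>) * cnj (H (of_real r * cis t) * cis (- (of_nat n * t)))"
        by (simp add: mult_ac)
    qed
    also have "\<dots> = of_real (r * (1 - r\<^sup>2) powr \<alpha>) *
        cnj (?I (\<lambda>t. H (of_real r * cis t) * cis (- (of_nat n * t))))"
      by (simp add: Henstock_Kurzweil_Integration.integral_cnj del: of_real_mult)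
    also have "?I (\<lambda>t. H (of_real r * cis t) * cis (- (of_nat n * t))) = 2 * pi * h n * of_real r ^ n"
      using fourier_coefficient_power_series[OF H, of "of_real r" 0 n] r by simp
    finally have ode': "of_real r * a' + of_real ?m * a r = 4 * pi * cnj (h n) * of_real (r ^ (n + 1) * (1 - r\<^sup>2) powr \<alpha>)"
      unfolding ode by simp
    have "(F has_vector_derivative (of_real (r ^ Suc n) * a' + of_real (?m * r ^ n) * a r) -
        4 * pi * cnj (h n) * of_real (r ^ (2 * n + 1) * (1 - r\<^sup>2) powr \<alpha>)) (at r)"
      unfolding F_def[abs_def]
      by (intro has_vector_derivative_diff has_vector_derivative_mult has_vector_derivative_mult_right
          has_vector_derivative_of_real a' E' r)
        (use DERIV_pow[of "Suc n" r UNIV] in simp)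
    moreover have "of_real (r ^ Suc n) * a' + of_real (?m * r ^ n) * a r =
        of_real (r ^ n) * (of_real r * a' + of_real ?m * a r)"
      by (simp add: algebra_simps)
    moreover have "of_real (r ^ n) * (4 * pi * cnj (h n) * of_real (r ^ (n + 1) * (1 - r\<^sup>2) powr \<alpha>)) =
        4 * pi * cnj (h n) * of_real (r ^ (2 * n + 1) * (1 - r\<^sup>2) powr \<alpha>)"
      by (simp add: power_add mult_2)
    ultimately show ?thesis by (simp only: ode' diff_self)
  qed
  have "F r = F 0" if "r \<in> {0<..<1}" for r
  proof -
    have "(F has_vector_derivative 0) (at x within {-1<..<1})" if "x \<in> {-1<..<1}" for x
      using that by (intro has_vector_derivative_at_within[OF F']) (simp add: abs_less_iff)
    then obtain c where "\<And>x. x \<in> {-1<..<1} \<Longrightarrow> F x = c"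
      using has_vector_derivative_zero_constant[of "{-1<..<1}" F] convex_real_interval(8) by metis
    then have "F r = c" "F 0 = c" using that by auto
    then show ?thesis by simp
  qed
  then have "\<forall>\<^sub>F r in at_left 1. F r = F 0"
    by (intro eventually_mono[OF eventually_at_left_real[of 0 1]]) simp_all
  then have "(F \<longlongrightarrow> F 0) (at_left 1)"
    by (rule tendsto_eventually)
  moreover have "(F \<longlongrightarrow> of_real (1 ^ Suc n) * ?I (\<lambda>t. fstar (cis t) * cis (?m * t)) - 4 * pi * cnj (h n) * of_real 0) (at_left 1)"
    unfolding F_def[abs_def] a_def
    by (intro tendsto_intros E1 tendsto_fourier_coefficient[OF bv, of "\<lambda>z. z ^ Suc n"])
      (simp only: Complex.DeMoivre)
  ultimately have "F 0 = of_real (1 ^ Suc n) * ?I (\<lambda>t. fstar (cis t) * cis (?m * t)) - 4 * pi * cnj (h n) * of_real 0"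
    by (rule tendsto_unique[OF trivial_limit_at_left_real])
  then have "?I (\<lambda>t. fstar (cis t) * cis (?m * t)) = F 0"
    by (simp only: power_one of_real_1 of_real_0 mult_1 mult_zero_right diff_zero)
  \<comment> \<open>The factor \<open>r ^ Suc n\<close> vanishes at 0, so \<open>a 0\<close> drops
    out.\<close>
  also have "F 0 = 4 * pi * cnj (h n) * of_real (fact n / (2 * pochhammer (\<alpha> + 1) (Suc n)))"
    unfolding F_def E0 by simp
  finally have I: "?I (\<lambda>t. fstar (cis t) * cis (?m * t)) =
      4 * pi * cnj (h n) * of_real (fact n / (2 * pochhammer (\<alpha> + 1) (Suc n)))" .
  have "pochhammer (\<alpha> + 1) (Suc n) > 0"
    using \<alpha> by (intro pochhammer_pos) simp
  then show ?thesis
    unfolding I by (simp add: field_simps)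
qed

text \<open>The coefficients of \<open>H\<close> are Fourier coefficients of \<open>fstar\<close>
  times \<open>(\<alpha>+1)_(n+1) / n! = (\<alpha>+1) (\<alpha>+2)_n / n!\<close>. Summing under the
  integral gives the binomial series of exponent \<open>-(\<alpha>+2)\<close>; the extra
  \<open>cis t\<close> comes from the index shift.\<close>

lemma alpha_harmonic_d_zbar_integral:
  fixes f fstar :: "complex \<Rightarrow> complex"
  assumes \<alpha>: "\<alpha> > -1" and fstar: "continuous_on (sphere 0 1) fstar"
    and f: "alpha_harmonic \<alpha> f" and bv: "distributional_boundary_values f fstar"
    and z: "z \<in> ball 0 1"
  shows "2 * pi * d_zbar f z = integral {0..2 * pi} (\<lambda>t. fstar (cis t) *
    (of_real ((\<alpha> + 1) * (1 - (cmod z)\<^sup>2) powr \<alpha>) * cis t * (1 - cnj z * cis t) powr (- of_real (\<alpha> + 2))))"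
proof -
  let ?I = "integral {0..2 * pi}"
  obtain h H where H: "\<And>w. w \<in> ball 0 1 \<Longrightarrow> (\<lambda>n. h n * w ^ n) sums H w"
    and fH: "\<And>z. z \<in> ball 0 1 \<Longrightarrow> d_zbar f z = of_real ((1 - (cmod z)\<^sup>2) powr \<alpha>) * cnj (H z)"
    using alpha_harmonic_d_zbar[OF f] by blast
  have "(\<lambda>n. pochhammer (complex_of_real (\<alpha> + 2)) n / fact n * cnj z ^ n * ?I (\<lambda>t. cis (of_nat n * t) * (cis t * fstar (cis t)))) sums
      ?I (\<lambda>t. (1 - cnj z * cis t) powr (- of_real (\<alpha> + 2)) * (cis t * fstar (cis t)))"
    using z by (intro integral_power_series[OF binomial_series]) (auto intro!: continuous_intros continuous_on_circle fstar)
  then have "(\<lambda>n. of_real (\<alpha> + 1) * (pochhammer (complex_of_real (\<alpha> + 2)) n / fact n * cnj z ^ n * ?I (\<lambda>t. cis (of_nat n * t) * (cis t * fstar (cis t))))) sums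
      (of_real (\<alpha> + 1) * ?I (\<lambda>t. (1 - cnj z * cis t) powr (- of_real (\<alpha> + 2)) * (cis t * fstar (cis t))))"
    by (rule sums_mult)
  moreover have "of_real (\<alpha> + 1) * (pochhammer (complex_of_real (\<alpha> + 2)) n / fact n * cnj z ^ n * ?I (\<lambda>t. cis (of_nat n * t) * (cis t * fstar (cis t)))) =
      2 * pi * (cnj (h n) * cnj z ^ n)" for n
  proof -
    have "?I (\<lambda>t. cis (of_nat n * t) * (cis t * fstar (cis t))) = ?I (\<lambda>t. fstar (cis t) * cis (real (Suc n) * t))"
      by (rule integral_cong) (simp add: cis_mult distrib_right add.commute flip: mult.assoc)
    moreover have "of_real (pochhammer (\<alpha> + 1) (Suc n) / fact n) = of_real (\<alpha> + 1) * pochhammer (complex_of_real (\<alpha> + 2)) n / fact n"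
      unfolding pochhammer_of_real pochhammer_rec by (simp add: add.commute)
    ultimately have "2 * pi * cnj (h n) = of_real (\<alpha> + 1) * pochhammer (complex_of_real (\<alpha> + 2)) n / fact n *
        ?I (\<lambda>t. cis (of_nat n * t) * (cis t * fstar (cis t)))"
      using alpha_harmonic_negative_coefficient[OF \<alpha> f bv H fH, of n] by (simp only:)
    then have "2 * pi * cnj (h n) * cnj z ^ n = of_real (\<alpha> + 1) * pochhammer (complex_of_real (\<alpha> + 2)) n / fact n *
        ?I (\<lambda>t. cis (of_nat n * t) * (cis t * fstar (cis t))) * cnj z ^ n"
      by (simp only:)
    then show ?thesis by (simp only: mult_ac times_divide_eq_left times_divide_eq_right)
  qed
  ultimately have "(\<lambda>n. 2 * pi * (cnj (h n) * cnj z ^ n)) sums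
      (of_real (\<alpha> + 1) * ?I (\<lambda>t. (1 - cnj z * cis t) powr (- of_real (\<alpha> + 2)) * (cis t * fstar (cis t))))"
    by (simp only:)
  moreover have "(\<lambda>n. 2 * pi * (cnj (h n) * cnj z ^ n)) sums (2 * pi * cnj (H z))"
    using sums_mult[OF sums_cnj[THEN iffD2, OF H[OF z]], of "2 * pi"] by simp
  ultimately have *: "2 * pi * cnj (H z) = of_real (\<alpha> + 1) * ?I (\<lambda>t. (1 - cnj z * cis t) powr (- of_real (\<alpha> + 2)) * (cis t * fstar (cis t)))"
    using sums_unique2 by blast
  have "2 * pi * d_zbar f z = of_real ((1 - (cmod z)\<^sup>2) powr \<alpha>) * (2 * pi * cnj (H z))"
    by (simp add: fH[OF z])
  also have "\<dots> = of_real ((\<alpha> + 1) * (1 - (cmod z)\<^sup>2) powr \<alpha>) * ?I (\<lambda>t. (1 - cnj z * cis t) powr (- of_real (\<alpha> + 2)) * (cis t * fstar (cis t)))"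
    unfolding * by simp
  also have "\<dots> = ?I (\<lambda>t. of_real ((\<alpha> + 1) * (1 - (cmod z)\<^sup>2) powr \<alpha>) * ((1 - cnj z * cis t) powr (- of_real (\<alpha> + 2)) * (cis t * fstar (cis t))))"
    by (simp only: integral_mult_right)
  finally show ?thesis by (simp only: mult_ac)
qed

section \<open>The Poisson integral\<close>

text \<open>The kernel is not normalised: the Poisson integral carries a factor \<open>1 / (2 \<pi>)\<close>.\<close>

definition poisson_kernel :: "real \<Rightarrow> complex \<Rightarrow> real \<Rightarrow> complex" where
  "poisson_kernel \<alpha> z t = of_real ((1 - (cmod z)\<^sup>2) powr (\<alpha> + 1)) *
    (inverse (1 - z * cis (- t)) * (1 - cnj z * cis t) powr (- of_real (\<alpha> + 1)))"

text \<open>The derivative of the kernel in \<open>z\<close>, simplified so that its numerator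
  combines two factors of equal modulus, \<open>1 - cnj z * cis t\<close> and
  \<open>1 - z * cis (- t)\<close>; this makes the triangle inequality effective.\<close>

definition poisson_kernel_z :: "real \<Rightarrow> complex \<Rightarrow> real \<Rightarrow> complex" where
  "poisson_kernel_z \<alpha> z t = of_real ((1 - (cmod z)\<^sup>2) powr \<alpha>) *
    (cis (- t) * (1 - cnj z * cis t) - of_real \<alpha> * cnj z * (1 - z * cis (- t))) *
    (inverse (1 - z * cis (- t)))\<^sup>2 * (1 - cnj z * cis t) powr (- of_real (\<alpha> + 1))"

text \<open>The derivative of the kernel in \<open>cnj z\<close>, which coincides with the kernel
  already found for \<open>d_zbar f\<close>.\<close>

definition poisson_kernel_zbar :: "real \<Rightarrow> complex \<Rightarrow> real \<Rightarrow> complex" where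
  "poisson_kernel_zbar \<alpha> z t = of_real ((\<alpha> + 1) * (1 - (cmod z)\<^sup>2) powr \<alpha>) * cis t *
    (1 - cnj z * cis t) powr (- of_real (\<alpha> + 2))"

lemma one_minus_mult_cis:
  assumes "z \<in> ball 0 1"
  shows "1 - z * cis t \<noteq> 0"
    "1 - cnj z * cis t \<notin> \<real>\<^sub>\<le>\<^sub>0" "1 - cnj z * cis t \<noteq> 0" "0 < Re (1 - cnj z * cis t)"
  using assms by (intro one_minus_in_slit_plane; simp add: norm_mult)+

lemma cmod_one_minus_mult_cis: "cmod (1 - z * cis (- t)) = cmod (1 - cnj z * cis t)"
proof -
  have "1 - z * cis (- t) = cnj (1 - cnj z * cis t)" by (simp add: cis_cnj)
  then show ?thesis by (simp only: complex_mod_cnj)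
qed

lemma poisson_kernel_has_derivative:
  assumes z: "z \<in> ball 0 1"
  shows "((\<lambda>z. poisson_kernel \<alpha> z t) has_derivative
    (\<lambda>h. poisson_kernel_z \<alpha> z t * h + poisson_kernel_zbar \<alpha> z t * cnj h)) (at z)"
proof -
  define x where "x = 1 - (cmod z)\<^sup>2"
  define c where "c = cis t"
  define d where "d = cis (- t)"
  have cd: "c * d = 1" by (simp add: c_def d_def cis_mult)
  have x: "x > 0" using one_minus_cmod2_pos[OF z] by (simp add: x_def)
  have xc: "complex_of_real x = 1 - z * cnj z"
    unfolding x_def of_real_diff complex_norm_square by simp
  define u where "u = 1 - z * d"
  define v where "v = 1 - cnj z * c"
  have u: "u \<noteq> 0" using one_minus_mult_cis(1)[OF z, of "- t"] by (simp add: u_def d_def)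
  have v: "v \<noteq> 0" "v \<notin> \<real>\<^sub>\<le>\<^sub>0" using one_minus_mult_cis(2,3)[OF z, of t] by (simp_all add: v_def c_def)
  let ?s = "- complex_of_real (\<alpha> + 1)"
  have W: "((\<lambda>w. complex_of_real ((1 - (cmod w)\<^sup>2) powr (\<alpha> + 1))) has_derivative
    (\<lambda>h. of_real (- (\<alpha> + 1) * x powr \<alpha>) * (cnj z * h + z * cnj h))) (at z)"
    using has_derivative_weight[OF z, of "\<alpha> + 1"] by (simp add: x_def)
  have "((\<lambda>w. inverse (1 - w * d)) has_field_derivative d * (inverse u)\<^sup>2) (at z)"
    unfolding u_def using u[unfolded u_def]
    by (auto intro!: derivative_eq_intros simp: power2_eq_square divide_inverse)
  then have I: "((\<lambda>w. inverse (1 - w * d)) has_derivative (\<lambda>h. d * (inverse u)\<^sup>2 * h)) (at z)"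
    by (simp add: has_field_derivative_def)
  have "((\<lambda>w. (1 - w * c) powr ?s) has_field_derivative ?s * v powr (?s - 1) * - c) (at (cnj z))"
    unfolding v_def using v[unfolded v_def]
    by (auto intro!: derivative_eq_intros)
  then have "((\<lambda>w. (1 - w * c) powr ?s) has_derivative (\<lambda>h. ?s * v powr (?s - 1) * - c * h)) (at (cnj z))"
    by (simp only: has_field_derivative_def)
  from has_derivative_compose[OF has_derivative_cnj[OF has_derivative_ident] this]
  have P: "((\<lambda>w. (1 - cnj w * c) powr ?s) has_derivative (\<lambda>h. ?s * v powr (?s - 1) * - c * cnj h)) (at z)"
    by simp
  \<comment> \<open>With \<open>p\<close> as common power and \<open>q\<close> for the inverse of
    \<open>u\<close>, the comparison of derivatives becomes polynomial algebra.\<close>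
  define p where "p = v powr (?s - 1)"
  have p: "v powr ?s = p * v" "v powr (- of_real (\<alpha> + 2)) = p"
  proof -
    have "v powr (?s - 1 + 1) = v powr (?s - 1) * v powr 1" by (rule powr_add)
    moreover have "v powr 1 = v" using v by simp
    ultimately show "v powr ?s = p * v" by (simp only: diff_add_cancel p_def)
    have "- complex_of_real (\<alpha> + 2) = ?s - 1" by simp
    then show "v powr (- of_real (\<alpha> + 2)) = p" by (simp only: p_def)
  qed
  have xp: "of_real (x powr (\<alpha> + 1)) = of_real (x powr \<alpha>) * (1 - z * cnj z)"
    using x by (simp add: powr_add flip: xc)
  have *: "((\<lambda>z. poisson_kernel \<alpha> z t) has_derivative
    (\<lambda>h. of_real (x powr (\<alpha> + 1)) * (inverse u * (?s * p * - c * cnj h) + d * (inverse u)\<^sup>2 * h * v powr ?s) +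
      of_real (- (\<alpha> + 1) * x powr \<alpha>) * (cnj z * h + z * cnj h) * (inverse u * v powr ?s))) (at z)"
    using has_derivative_mult[OF W has_derivative_mult[OF I P]]
    unfolding poisson_kernel_def c_def[symmetric] d_def[symmetric] x_def[symmetric] u_def[symmetric] v_def[symmetric] p_def[symmetric] .
  have kz: "poisson_kernel_z \<alpha> z t = of_real (x powr \<alpha>) * (d * v - of_real \<alpha> * cnj z * u) * (inverse u)\<^sup>2 * (p * v)"
    and kzb: "poisson_kernel_zbar \<alpha> z t = of_real ((\<alpha> + 1) * x powr \<alpha>) * c * p"
    unfolding poisson_kernel_z_def poisson_kernel_zbar_def c_def[symmetric] d_def[symmetric] x_def[symmetric] u_def[symmetric] v_def[symmetric] p
    by simp_all
  define q where "q = inverse u"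
  have q: "q * u = 1" using u by (simp add: q_def)
  \<comment> \<open>The product rule leaves these two numerators. By \<open>c * d = 1\<close>,
    \<open>(1 - z * cnj z) * d - cnj z * u\<close> and \<open>d * v\<close> are both
    \<open>d - cnj z\<close>, while both sides of the second identity are
    \<open>c - z\<close>.\<close>
  have 1: "(1 - z * cnj z) * d - of_real (\<alpha> + 1) * cnj z * u = d * v - of_real \<alpha> * cnj z * u"
    unfolding u_def v_def of_real_add of_real_1 using cd by algebra
  have 2: "(1 - z * cnj z) * c - z * v = c * u"
    unfolding u_def v_def using cd by algebra
  have "of_real (x powr (\<alpha> + 1)) * (inverse u * (?s * p * - c * cnj h) + d * (inverse u)\<^sup>2 * h * v powr ?s) +
      of_real (- (\<alpha> + 1) * x powr \<alpha>) * (cnj z * h + z * cnj h) * (inverse u * v powr ?s) =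
      poisson_kernel_z \<alpha> z t * h + poisson_kernel_zbar \<alpha> z t * cnj h" (is "?L = ?R") for h
  proof -
    let ?X = "complex_of_real (x powr \<alpha>)" and ?a = "complex_of_real (\<alpha> + 1)"
    have "?L = ?X * q\<^sup>2 * p * v * h * ((1 - z * cnj z) * d - ?a * cnj z * u) +
        ?X * ?a * p * q * cnj h * ((1 - z * cnj z) * c - z * v)"
      unfolding xp p(1) q_def[symmetric] using q
      by (simp add: power2_eq_square) algebra
    also have "\<dots> = ?R"
      unfolding 1 2 kz kzb q_def[symmetric] using q
      by (simp add: power2_eq_square)
    finally show ?thesis .
  qed
  then show ?thesis using * by (simp only:)
qed

lemma continuous_on_poisson_kernel:
  shows "continuous_on (ball 0 1 \<times> S) (\<lambda>(z, t). poisson_kernel \<alpha> z t)"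
    and "continuous_on (ball 0 1 \<times> S) (\<lambda>(z, t). poisson_kernel_z \<alpha> z t)"
    and "continuous_on (ball 0 1 \<times> S) (\<lambda>(z, t). poisson_kernel_zbar \<alpha> z t)"
proof -
  have W: "continuous_on (ball 0 1 \<times> S) (\<lambda>x. complex_of_real ((1 - (cmod (fst x))\<^sup>2) powr \<beta>))" for \<beta>
    using one_minus_cmod2_pos by (intro continuous_intros) force
  have P: "continuous_on (ball 0 1 \<times> S) (\<lambda>x. (1 - cnj (fst x) * cis (snd x)) powr \<beta>)" for \<beta>
  proof (rule continuous_on_powr_complex)
    have *: "1 - cnj (fst x) * cis (snd x) \<noteq> 0" "0 < Re (1 - cnj (fst x) * cis (snd x))"
      if "x \<in> ball 0 1 \<times> S" for x
    proof -
      from that have "fst x \<in> ball 0 1" by auto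
      then show "1 - cnj (fst x) * cis (snd x) \<noteq> 0" "0 < Re (1 - cnj (fst x) * cis (snd x))"
        by (rule one_minus_mult_cis)+
    qed
    show "ball 0 1 \<times> S \<subseteq> {x. 0 \<le> Re (1 - cnj (fst x) * cis (snd x)) \<or> Im (1 - cnj (fst x) * cis (snd x)) \<noteq> 0}"
      by (intro subsetI CollectI disjI1 less_imp_le *)
    \<comment> \<open>This side condition concerns only zeros of the base, and there are
      none.\<close>
    show "0 < Re \<beta>" if "x \<in> ball 0 1 \<times> S" "1 - cnj (fst x) * cis (snd x) = 0" for x
      using *(1)[OF that(1)] that(2) by contradiction
  qed (intro continuous_intros)+
  have I: "continuous_on (ball 0 1 \<times> S) (\<lambda>x. inverse (1 - fst x * cis (- snd x)))"
    by (intro continuous_intros) (use one_minus_mult_cis(1) in auto)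
  have c: "continuous_on (ball 0 1 \<times> S) (\<lambda>x. fst x)"
    "continuous_on (ball 0 1 \<times> S) (\<lambda>x. cnj (fst x))"
    "continuous_on (ball (0::complex) 1 \<times> S) (\<lambda>x. cis (snd x))"
    "continuous_on (ball (0::complex) 1 \<times> S) (\<lambda>x. cis (- snd x))"
    by (intro continuous_intros)+
  show "continuous_on (ball 0 1 \<times> S) (\<lambda>(z, t). poisson_kernel \<alpha> z t)"
    "continuous_on (ball 0 1 \<times> S) (\<lambda>(z, t). poisson_kernel_z \<alpha> z t)"
    "continuous_on (ball 0 1 \<times> S) (\<lambda>(z, t). poisson_kernel_zbar \<alpha> z t)"
    unfolding poisson_kernel_def poisson_kernel_z_def poisson_kernel_zbar_def split_beta of_real_mult
    by (intro continuous_on_mult continuous_on_diff continuous_on_power continuous_on_const W P I c)+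
qed

section \<open>The Poisson integral of the boundary function and its equality with
  \<open>f\<close>\<close>

lemma poisson_integral_has_derivative:
  fixes fstar :: "complex \<Rightarrow> complex"
  assumes fstar: "continuous_on (sphere 0 1) fstar" and z: "z \<in> ball 0 1"
  shows "((\<lambda>z. integral {0..2 * pi} (\<lambda>t. fstar (cis t) * poisson_kernel \<alpha> z t)) has_derivative
    (\<lambda>h. integral {0..2 * pi} (\<lambda>t. fstar (cis t) * poisson_kernel_z \<alpha> z t) * h +
         integral {0..2 * pi} (\<lambda>t. fstar (cis t) * poisson_kernel_zbar \<alpha> z t) * cnj h)) (at z)"
proof (rule wirtinger_leibniz[OF open_ball convex_ball z])
  have c: "continuous_on (ball 0 1 \<times> {0..2 * pi}) (\<lambda>x. fstar (cis (snd x)))"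
    by (rule continuous_on_compose2[OF continuous_on_circle[OF fstar, of UNIV] continuous_on_snd]) auto
  show "continuous_on (ball 0 1 \<times> {0..2 * pi}) (\<lambda>(z, t). fstar (cis t) * poisson_kernel_z \<alpha> z t)"
    "continuous_on (ball 0 1 \<times> {0..2 * pi}) (\<lambda>(z, t). fstar (cis t) * poisson_kernel_zbar \<alpha> z t)"
    using c continuous_on_poisson_kernel(2,3)[of "{0..2 * pi}" \<alpha>]
    unfolding split_beta by (auto intro: continuous_on_mult)
next
  fix w t assume w: "w \<in> ball (0::complex) 1"
  show "((\<lambda>z. fstar (cis t) * poisson_kernel \<alpha> z t) has_derivative
      (\<lambda>h. fstar (cis t) * poisson_kernel_z \<alpha> w t * h + fstar (cis t) * poisson_kernel_zbar \<alpha> w t * cnj h)) (at w)"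
    using has_derivative_mult_right[OF poisson_kernel_has_derivative[OF w, of \<alpha> t], of "fstar (cis t)"]
    by (simp add: algebra_simps)
next
  fix w assume w: "w \<in> ball (0::complex) 1"
  have "continuous_on {0..2 * pi} (\<lambda>t. (w, t))" by (intro continuous_intros)
  from continuous_on_compose2[OF continuous_on_poisson_kernel(1)[of "{0..2 * pi}" \<alpha>] this]
  show "continuous_on {0..2 * pi} (\<lambda>t. fstar (cis t) * poisson_kernel \<alpha> w t)"
    using w by (intro continuous_on_mult continuous_on_circle fstar) (simp add: image_subset_iff)
qed

text \<open>The coefficient is taken in the position angle \<open>s\<close>, for fixed
  \<open>t\<close>. Geometric terms of index \<open>j + n\<close> pair with binomial terms of index
  \<open>j\<close>, so the sum over \<open>j\<close> is the binomial series at \<open>r^2\<close>,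
  namely \<open>(1 - r^2) powr (- (\<alpha> + 1))\<close>, which the weight cancels.\<close>

lemma poisson_kernel_fourier_coefficient:
  assumes r: "0 \<le> r" "r < 1"
  shows "integral {0..2 * pi} (\<lambda>s. poisson_kernel \<alpha> (of_real r * cis s) t * cis (- (of_nat n * s))) =
    2 * pi * of_real r ^ n * cis (- (of_nat n * t))"
proof -
  let ?I = "integral {0..2 * pi}"
  define x where "x = 1 - r\<^sup>2"
  have x: "x > 0" using r by (simp add: x_def abs_square_less_1)
  define c where "c = of_real r * cis (- t)"
  have c: "cmod c < 1" "c \<in> ball 0 1" using r by (simp_all add: c_def norm_mult)
  define P where "P w = (1 - w) powr (- complex_of_real (\<alpha> + 1))" for w
  define b where "b j = pochhammer (complex_of_real (\<alpha> + 1)) j / fact j" for j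
  have P: "(\<lambda>j. b j * w ^ j) sums P w" if "w \<in> ball 0 1" for w
    using binomial_series[OF that] unfolding P_def b_def .
  have geom: "(\<lambda>j. 1 * w ^ j) sums inverse (1 - w)" if "w \<in> ball 0 1" for w :: complex
    using geometric_sums[of w] that by (simp add: divide_inverse)
  have coeff: "?I (\<lambda>s. cis (of_nat j * s) * (cnj (inverse (1 - c * cis s)) * cis (of_nat n * s))) = 2 * pi * cnj c ^ (j + n)" for j
  proof -
    have "?I (\<lambda>s. cis (of_nat j * s) * (cnj (inverse (1 - c * cis s)) * cis (of_nat n * s))) =
      cnj (?I (\<lambda>s. inverse (1 - c * cis s) * cis (- (of_nat (j + n) * s))))"
      unfolding Henstock_Kurzweil_Integration.integral_cnj
      by (rule integral_cong) (simp add: cis_cnj cis_mult algebra_simps)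
    also have "\<dots> = cnj (2 * pi * c ^ (j + n))"
      using fourier_coefficient_power_series[OF geom c(1), of 0 "j + n"] by simp
    finally show ?thesis by simp
  qed
  have "continuous_on {0..2 * pi} (\<lambda>s. inverse (1 - c * cis s))"
    using one_minus_mult_cis(1)[OF c(2)] by (intro continuous_intros) simp
  moreover have "continuous_on {0..2 * pi} (\<lambda>s. cis (of_nat n * s))"
    by (intro continuous_intros)
  ultimately have "(\<lambda>j. b j * c ^ j * ?I (\<lambda>s. cis (of_nat j * s) * (cnj (inverse (1 - c * cis s)) * cis (of_nat n * s)))) sums
      ?I (\<lambda>s. P (c * cis s) * (cnj (inverse (1 - c * cis s)) * cis (of_nat n * s)))"
    by (intro integral_power_series[OF P c(1)] continuous_on_mult continuous_on_cnj)
  moreover have "b j * c ^ j * (2 * pi * cnj c ^ (j + n)) = 2 * pi * cnj c ^ n * (b j * of_real (r\<^sup>2) ^ j)" for j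
  proof -
    have "c * cnj c = of_real (r\<^sup>2)"
      using r by (simp add: c_def cis_cnj cis_mult power2_eq_square)
    then have "of_real (r\<^sup>2) ^ j = c ^ j * cnj c ^ j"
      by (simp flip: power_mult_distrib)
    then show ?thesis by (simp add: power_add mult_ac)
  qed
  moreover have "(\<lambda>j. 2 * pi * cnj c ^ n * (b j * of_real (r\<^sup>2) ^ j)) sums (2 * pi * cnj c ^ n * P (of_real (r\<^sup>2)))"
    using r by (intro sums_mult P) (simp add: abs_square_less_1 norm_power)
  ultimately have "?I (\<lambda>s. P (c * cis s) * (cnj (inverse (1 - c * cis s)) * cis (of_nat n * s))) =
      2 * pi * cnj c ^ n * P (of_real (r\<^sup>2))"
    unfolding coeff using sums_unique2 by (metis (no_types, lifting) sums_cong)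
  moreover have "P (of_real (r\<^sup>2)) = of_real (x powr (- (\<alpha> + 1)))"
    using x powr_of_real[of x "- (\<alpha> + 1)"] by (simp add: P_def x_def)
  ultimately have "of_real (x powr (\<alpha> + 1)) * ?I (\<lambda>s. P (c * cis s) * (cnj (inverse (1 - c * cis s)) * cis (of_nat n * s))) =
      2 * pi * cnj c ^ n * of_real (x powr (\<alpha> + 1) * x powr (- (\<alpha> + 1)))"
    by simp
  also have "x powr (\<alpha> + 1) * x powr (- (\<alpha> + 1)) = 1"
    using x by (simp flip: powr_add)
  \<comment> \<open>The computation was done for the conjugate of the integrand, whose binomial
    factor \<open>P\<close> is a power series in \<open>c * cis s\<close>; conjugating returns to
    the kernel.\<close>
  finally have "cnj (of_real (x powr (\<alpha> + 1)) * ?I (\<lambda>s. P (c * cis s) * (cnj (inverse (1 - c * cis s)) * cis (of_nat n * s)))) =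
      cnj (2 * pi * cnj c ^ n)" by simp
  also have "cnj (2 * pi * cnj c ^ n) = 2 * pi * of_real r ^ n * cis (- (of_nat n * t))"
    by (simp add: c_def power_mult_distrib Complex.DeMoivre)
  also have "cnj (of_real (x powr (\<alpha> + 1)) * ?I (\<lambda>s. P (c * cis s) * (cnj (inverse (1 - c * cis s)) * cis (of_nat n * s)))) =
    ?I (\<lambda>s. cnj (of_real (x powr (\<alpha> + 1)) * (P (c * cis s) * (cnj (inverse (1 - c * cis s)) * cis (of_nat n * s)))))"
    by (simp only: flip: Henstock_Kurzweil_Integration.integral_cnj integral_mult_right)
  also have "\<dots> = ?I (\<lambda>s. poisson_kernel \<alpha> (of_real r * cis s) t * cis (- (of_nat n * s)))"
  proof (rule integral_cong)
    fix s
    have w: "c * cis s \<in> ball 0 1"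
      using c by (simp add: norm_mult)
    have "cnj (P (c * cis s)) = P (cnj (c * cis s))"
    proof -
      have "cnj ((1 - c * cis s) powr (- of_real (\<alpha> + 1))) = cnj (1 - c * cis s) powr cnj (- of_real (\<alpha> + 1))"
        by (rule cnj_powr, rule less_imp_le, rule one_minus_in_slit_plane(3)) (use w in simp)
      then show ?thesis
        unfolding P_def
        by (simp only: complex_cnj_diff complex_cnj_one complex_cnj_minus complex_cnj_complex_of_real)
    qed
    moreover have "cmod (of_real r * cis s) = r" using r by (simp add: norm_mult)
    moreover have "c * cis s = of_real r * cis s * cis (- t)" by (simp add: c_def)
    moreover have "cnj (c * cis s) = cnj (of_real r * cis s) * cis t" by (simp add: c_def cis_cnj)
    ultimately show "cnj (of_real (x powr (\<alpha> + 1)) * (P (c * cis s) * (cnj (inverse (1 - c * cis s)) * cis (of_nat n * s)))) =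
        poisson_kernel \<alpha> (of_real r * cis s) t * cis (- (of_nat n * s))"
      unfolding poisson_kernel_def by (simp only: complex_cnj_mult complex_cnj_cnj complex_cnj_complex_of_real cis_cnj x_def P_def mult_ac)
  qed
  finally show ?thesis .
qed

lemma poisson_integral:
  fixes f fstar :: "complex \<Rightarrow> complex"
  assumes \<alpha>: "\<alpha> > -1" and fstar: "continuous_on (sphere 0 1) fstar"
    and f: "alpha_harmonic \<alpha> f" and bv: "distributional_boundary_values f fstar"
    and z: "z \<in> ball 0 1"
  shows "2 * pi * f z = integral {0..2 * pi} (\<lambda>t. fstar (cis t) * poisson_kernel \<alpha> z t)"
proof -
  let ?I = "integral {0..2 * pi}"
  define Q where "Q z = ?I (\<lambda>t. fstar (cis t) * poisson_kernel \<alpha> z t)" for z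
  note fc = continuous_on_circle[OF fstar]
  have cont_f: "continuous_on (ball 0 1) f"
    using alpha_harmonic_differentiable(1)[OF f]
    by (auto intro!: continuous_at_imp_continuous_on differentiable_imp_continuous_within)
  define v where "v z = 2 * pi * f z - Q z" for z
  have v': "(v has_derivative (\<lambda>h. (2 * pi * d_z f z - ?I (\<lambda>t. fstar (cis t) * poisson_kernel_z \<alpha> z t)) * h)) (at z)"
    if z: "z \<in> ball 0 1" for z
  proof -
    have Q': "(Q has_derivative (\<lambda>h. ?I (\<lambda>t. fstar (cis t) * poisson_kernel_z \<alpha> z t) * h +
        ?I (\<lambda>t. fstar (cis t) * poisson_kernel_zbar \<alpha> z t) * cnj h)) (at z)"
      unfolding Q_def[abs_def] by (rule poisson_integral_has_derivative[OF fstar z])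
    have "(v has_derivative (\<lambda>h. 2 * pi * (d_z f z * h + d_zbar f z * cnj h) -
      (?I (\<lambda>t. fstar (cis t) * poisson_kernel_z \<alpha> z t) * h + ?I (\<lambda>t. fstar (cis t) * poisson_kernel_zbar \<alpha> z t) * cnj h))) (at z)"
      unfolding v_def[abs_def]
      by (intro has_derivative_diff has_derivative_mult_right wirtinger_has_derivative
          alpha_harmonic_differentiable(1)[OF f z] Q')
    \<comment> \<open>The \<open>cnj h\<close> terms cancel, so the derivative of \<open>v\<close>
      is complex linear.\<close>
    moreover have "2 * pi * d_zbar f z = ?I (\<lambda>t. fstar (cis t) * poisson_kernel_zbar \<alpha> z t)"
      unfolding poisson_kernel_zbar_def by (rule alpha_harmonic_d_zbar_integral[OF \<alpha> fstar f bv z])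
    ultimately show ?thesis by (simp add: algebra_simps)
  qed
  then have hol: "v holomorphic_on ball 0 1"
    unfolding holomorphic_on_open[OF open_ball] has_field_derivative_def by blast
  define g where "g n = (deriv ^^ n) v 0 / fact n" for n
  have g: "(\<lambda>n. g n * w ^ n) sums v w" if "w \<in> ball 0 1" for w
    using holomorphic_power_series[OF hol that] by (simp add: g_def)
  \<comment> \<open>Since \<open>v\<close> is holomorphic, the frequencies \<open>n \<ge> 0\<close>
    suffice. On the circle of radius \<open>r\<close> the contribution of \<open>f\<close> tends to
    \<open>2 \<pi> L\<close>, by the boundary condition tested on \<open>cnj z ^ n\<close>; that of
    \<open>Q\<close> is \<open>2 \<pi> r ^ n L\<close>, so their difference vanishes in the
    limit.\<close>
  have "g n = 0" for n
  proof -
    define L where "L = ?I (\<lambda>t. fstar (cis t) * cis (- (of_nat n * t)))"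
    have Qn: "?I (\<lambda>s. Q (of_real r * cis s) * cis (- (of_nat n * s))) = 2 * pi * of_real r ^ n * L"
      if r: "r \<in> {0<..<1}" for r
    proof -
      have rs: "of_real r * cis s \<in> ball 0 1" for s using r by (simp add: norm_mult)
      have "continuous_on (cbox 0 (2 * pi) \<times> cbox 0 (2 * pi)) (\<lambda>x. (of_real r * cis (fst x), snd x :: real))"
        by (intro continuous_intros)
      from continuous_on_compose2[OF continuous_on_poisson_kernel(1)[of UNIV \<alpha>] this]
      have "continuous_on (cbox 0 (2 * pi) \<times> cbox 0 (2 * pi)) (\<lambda>x. poisson_kernel \<alpha> (of_real r * cis (fst x)) (snd x))"
        using rs by (simp add: image_subset_iff)
      then have cont: "continuous_on (cbox (0, 0) (2 * pi, 2 * pi))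
          (\<lambda>(s, t). fstar (cis t) * poisson_kernel \<alpha> (of_real r * cis s) t * cis (- (of_nat n * s)))"
        unfolding split_beta cbox_Pair_eq
        by (intro continuous_intros continuous_on_compose2[OF fc[of UNIV]]) auto
      have "?I (\<lambda>s. Q (of_real r * cis s) * cis (- (of_nat n * s))) =
          ?I (\<lambda>s. ?I (\<lambda>t. fstar (cis t) * poisson_kernel \<alpha> (of_real r * cis s) t * cis (- (of_nat n * s))))"
        unfolding Q_def by simp
      also have "\<dots> = ?I (\<lambda>t. ?I (\<lambda>s. fstar (cis t) * poisson_kernel \<alpha> (of_real r * cis s) t * cis (- (of_nat n * s))))"
        using integral_swap_continuous[OF cont] by simp
      also have "\<dots> = ?I (\<lambda>t. fstar (cis t) * (2 * pi * of_real r ^ n * cis (- (of_nat n * t))))"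
        unfolding mult.assoc integral_mult_right
        using r poisson_kernel_fourier_coefficient[of r \<alpha> _ n] by (simp add: mult.assoc)
      also have "\<dots> = ?I (\<lambda>t. (2 * pi * of_real r ^ n) * (fstar (cis t) * cis (- (of_nat n * t))))"
        by (simp only: mult_ac)
      finally show ?thesis by (simp only: integral_mult_right L_def)
    qed
    have "2 * pi * g n * of_real r ^ n =
        2 * pi * ?I (\<lambda>t. f (of_real r * cis t) * cis (- real n * t)) - 2 * pi * of_real r ^ n * L"
      if r: "r \<in> {0<..<1}" for r
    proof -
      have rs: "of_real r * cis s \<in> ball 0 1" for s using r by (simp add: norm_mult)
      have cf: "continuous_on {0..2 * pi} (\<lambda>t. f (of_real r * cis t))"
        by (rule continuous_on_compose2[OF cont_f]) (use rs in \<open>auto intro!: continuous_intros\<close>)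
      have cv: "continuous_on {0..2 * pi} (\<lambda>t. v (of_real r * cis t))"
        by (rule continuous_on_compose2[OF holomorphic_on_imp_continuous_on[OF hol]])
          (use rs in \<open>auto intro!: continuous_intros\<close>)
      have "2 * pi * g n * of_real r ^ n = ?I (\<lambda>t. v (of_real r * cis t) * cis (- (of_nat n * t)))"
        using fourier_coefficient_power_series[OF g, of "of_real r" 0 n] r by simp
      moreover have "?I (\<lambda>t. 2 * pi * (f (of_real r * cis t) * cis (- (of_nat n * t))) - v (of_real r * cis t) * cis (- (of_nat n * t))) =
          ?I (\<lambda>t. 2 * pi * (f (of_real r * cis t) * cis (- (of_nat n * t)))) - ?I (\<lambda>t. v (of_real r * cis t) * cis (- (of_nat n * t)))"
        by (intro Henstock_Kurzweil_Integration.integral_diff integrable_continuous_real continuous_intros cf cv)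
      moreover have "2 * pi * (f w * y) - v w * y = Q w * y" for w y
        by (simp add: v_def algebra_simps)
      ultimately show ?thesis
        unfolding Qn[OF r, symmetric] by (simp only: integral_mult_right minus_mult_left) simp
    qed
    then have "\<forall>\<^sub>F r in at_left 1. 2 * pi * g n * of_real r ^ n =
        2 * pi * ?I (\<lambda>t. f (of_real r * cis t) * cis (- real n * t)) - 2 * pi * of_real r ^ n * L"
      by (intro eventually_mono[OF eventually_at_left_real[of 0 1]]) simp_all
    moreover have "((\<lambda>r. 2 * pi * ?I (\<lambda>t. f (of_real r * cis t) * cis (- real n * t)) - 2 * pi * of_real r ^ n * L)
        \<longlongrightarrow> 2 * pi * ?I (\<lambda>t. fstar (cis t) * cis (- real n * t)) - 2 * pi * of_real 1 ^ n * L) (at_left 1)"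
      by (intro tendsto_intros tendsto_fourier_coefficient[OF bv, of "\<lambda>z. cnj z ^ n"])
        (simp add: cis_cnj Complex.DeMoivre)
    ultimately have "((\<lambda>r. 2 * pi * g n * of_real r ^ n) \<longlongrightarrow>
        2 * pi * ?I (\<lambda>t. fstar (cis t) * cis (- real n * t)) - 2 * pi * of_real 1 ^ n * L) (at_left 1)"
      using tendsto_cong by fast
    moreover have "((\<lambda>r. 2 * pi * g n * of_real r ^ n) \<longlongrightarrow> 2 * pi * g n * of_real 1 ^ n) (at_left 1)"
      by (intro tendsto_intros)
    ultimately have "2 * pi * g n * of_real 1 ^ n =
        2 * pi * ?I (\<lambda>t. fstar (cis t) * cis (- real n * t)) - 2 * pi * of_real 1 ^ n * L"
      using tendsto_unique[OF trivial_limit_at_left_real] by blast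
    then show ?thesis by (simp add: L_def)
  qed
  then have "v z = 0"
    using g[OF z] by (simp add: sums_iff)
  then show ?thesis by (simp add: v_def Q_def)
qed

section \<open>The estimate\<close>

text \<open>The essential bound holds almost everywhere; by continuity the set where it holds is
  closed, hence contains the open interval and then its end points.\<close>

lemma cmod_le_circle_norm_inf:
  fixes fstar :: "complex \<Rightarrow> complex"
  assumes fstar: "continuous_on (sphere 0 1) fstar" and t: "t \<in> {0..2 * pi}"
  shows "cmod (fstar (cis t)) \<le> circle_norm_inf fstar"
proof -
  let ?g = "\<lambda>t. ereal (cmod (fstar (cis t)))"
  define E where "E = esssup (lebesgue_on {0..2 * pi}) ?g"
  have cont: "continuous_on S (\<lambda>t. cmod (fstar (cis t)))" for S
    by (intro continuous_on_norm continuous_on_circle fstar)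
  have "bounded (fstar ` sphere 0 1)"
    using compact_continuous_image[OF fstar] compact_imp_bounded compact_sphere by blast
  then obtain B where "\<forall>\<zeta>\<in>sphere 0 1. cmod (fstar \<zeta>) \<le> B"
    unfolding bounded_iff by blast
  then have B: "cmod (fstar (cis t)) \<le> B" for t by simp
  have "?g \<in> borel_measurable (lebesgue_on {0..2 * pi})"
    by (intro borel_measurable_ereal continuous_imp_measurable_on_sets_lebesgue cont) simp
  then have EB: "E \<le> ereal B"
    unfolding E_def by (rule esssup_I) (use B in simp)
  have "AE t in lebesgue_on {0..2 * pi}. ?g t \<le> E"
    unfolding E_def by (rule esssup_AE)
  then have AE: "AE t \<in> {0<..<2 * pi} in lebesgue. t \<in> {t. ?g t \<le> E}"
    by (subst (asm) AE_restrict_space_iff) auto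
  have "continuous_on UNIV ?g"
    using cont by (intro continuous_on_ereal)
  then have closed: "closed {t. ?g t \<le> E}"
    by (intro closed_Collect_le continuous_on_const)
  have "{0<..<2 * pi} \<subseteq> {t. ?g t \<le> E}"
    using mem_closed_if_AE_lebesgue_open[OF open_greaterThanLessThan closed AE] by blast
  then have "closure {0<..<2 * pi} \<subseteq> {t. ?g t \<le> E}"
    using closed closure_minimal by blast
  then have E: "?g t \<le> E"
    using t by auto
  \<comment> \<open>Finiteness matters because \<open>real_of_ereal\<close> sends infinite values to
    0: \<open>E\<close> lies between a real value of \<open>?g\<close> and \<open>B\<close>.\<close>
  then obtain M where "E = ereal M"
    using EB by (cases E) auto
  then show ?thesis
    using E unfolding circle_norm_inf_def E_def by simp
qed

text \<open>The \<open>z\<close> derivative contributes \<open>1 + |\<alpha>|\<close>, by the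
  triangle inequality and \<open>|z| < 1\<close>; the other contributes exactly
  \<open>\<alpha> + 1\<close>.\<close>

lemma poisson_kernel_derivatives_bound:
  assumes \<alpha>: "\<alpha> > -1" and z: "z \<in> ball 0 1"
  shows "cmod (poisson_kernel_z \<alpha> z t) + cmod (poisson_kernel_zbar \<alpha> z t) \<le>
    (2 + \<alpha> + \<bar>\<alpha>\<bar>) * ((1 - (cmod z)\<^sup>2) powr \<alpha> * cmod (1 - cnj z * cis t) powr (- \<alpha> - 2))"
proof -
  define x where "x = (1 - (cmod z)\<^sup>2) powr \<alpha>"
  define d where "d = cmod (1 - cnj z * cis t)"
  have d: "d > 0" using one_minus_mult_cis(3)[OF z] by (simp add: d_def)
  have x: "x \<ge> 0" by (simp add: x_def)
  have d': "cmod (1 - z * cis (- t)) = d" by (simp add: d_def cmod_one_minus_mult_cis)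
  have powr: "cmod ((1 - cnj z * cis t) powr (- of_real \<beta>)) = d powr (- \<beta>)" for \<beta>
    using norm_powr_real_powr'[of "- of_real \<beta>" "1 - cnj z * cis t"] by (simp add: d_def)
  have "cmod (cis (- t) * (1 - cnj z * cis t) - of_real \<alpha> * cnj z * (1 - z * cis (- t))) \<le> d + \<bar>\<alpha>\<bar> * cmod z * d"
    by (rule order_trans[OF norm_triangle_ineq4]) (simp add: norm_mult d' flip: d_def)
  also have "\<dots> \<le> (1 + \<bar>\<alpha>\<bar>) * d"
  proof -
    have "\<bar>\<alpha>\<bar> * cmod z \<le> \<bar>\<alpha>\<bar> * 1" using z by (intro mult_left_mono) auto
    then have "\<bar>\<alpha>\<bar> * cmod z * d \<le> \<bar>\<alpha>\<bar> * d" using d by (intro mult_right_mono) auto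
    then show ?thesis by (simp add: distrib_right)
  qed
  finally have "cmod (poisson_kernel_z \<alpha> z t) \<le> x * ((1 + \<bar>\<alpha>\<bar>) * d) * (inverse d)\<^sup>2 * d powr (- (\<alpha> + 1))"
    unfolding poisson_kernel_z_def norm_mult norm_power norm_inverse d' powr
    using x by (intro mult_right_mono mult_mono) (simp_all add: x_def)
  also have "\<dots> = (1 + \<bar>\<alpha>\<bar>) * (x * d powr (- \<alpha> - 2))"
  proof -
    have "d powr (- \<alpha> - 2 + 1) = d powr (- \<alpha> - 2) * d"
      using d by (subst powr_add) simp
    moreover have "- \<alpha> - 2 + 1 = - (\<alpha> + 1)" by simp
    ultimately have "d powr (- (\<alpha> + 1)) = d powr (- \<alpha> - 2) * d" by (simp only:)
    then show ?thesis using d by (simp add: power2_eq_square field_simps)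
  qed
  finally have "cmod (poisson_kernel_z \<alpha> z t) \<le> (1 + \<bar>\<alpha>\<bar>) * (x * d powr (- \<alpha> - 2))" .
  moreover have "cmod (poisson_kernel_zbar \<alpha> z t) = (\<alpha> + 1) * (x * d powr (- \<alpha> - 2))"
    unfolding poisson_kernel_zbar_def norm_mult powr using \<alpha> x by (simp add: x_def norm_mult)
  ultimately show ?thesis
    unfolding x_def[symmetric] d_def[symmetric] by (simp add: algebra_simps)
qed

text \<open>Differentiate the Poisson representation, bound \<open>fstar\<close> by its norm and the
  kernels pointwise, and integrate the result with \<open>integral_weight_cmod_powr\<close>.\<close>

lemma D_norm_bound:
  fixes f fstar :: "complex \<Rightarrow> complex"
  assumes \<alpha>: "\<alpha> > -1" and fstar: "continuous_on (sphere 0 1) fstar"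
    and f: "alpha_harmonic \<alpha> f" and bv: "distributional_boundary_values f fstar"
    and z: "z \<in> ball 0 1"
  shows "D_norm f z \<le> (2 + \<alpha> + \<bar>\<alpha>\<bar>) * circle_norm_inf fstar / (1 - (cmod z)\<^sup>2) *
    hypergeom_2F1 (- \<alpha> / 2) (- \<alpha> / 2) 1 ((cmod z)\<^sup>2)"
proof -
  let ?I = "integral {0..2 * pi}" and ?M = "circle_norm_inf fstar" and ?C = "2 + \<alpha> + \<bar>\<alpha>\<bar>"
  let ?F = "hypergeom_2F1 (- \<alpha> / 2) (- \<alpha> / 2) 1 ((cmod z)\<^sup>2)"
  define x where "x = 1 - (cmod z)\<^sup>2"
  have x: "x > 0" using one_minus_cmod2_pos[OF z] by (simp add: x_def)
  define Q where "Q w = (1 / (2 * pi)) * ?I (\<lambda>t. fstar (cis t) * poisson_kernel \<alpha> w t)" for w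
  have Q': "(Q has_derivative (\<lambda>h. (1 / (2 * pi)) * ?I (\<lambda>t. fstar (cis t) * poisson_kernel_z \<alpha> z t) * h +
      (1 / (2 * pi)) * ?I (\<lambda>t. fstar (cis t) * poisson_kernel_zbar \<alpha> z t) * cnj h)) (at z)"
    using has_derivative_mult_right[OF poisson_integral_has_derivative[OF fstar z, of \<alpha>], of "1 / (2 * pi)"]
    unfolding Q_def[abs_def] by (simp only: distrib_left mult.assoc)
  have fQ: "f w = Q w" if "w \<in> ball 0 1" for w
    using poisson_integral[OF \<alpha> fstar f bv that] by (simp add: Q_def field_simps)
  have Q: "Q differentiable (at z)" using Q' differentiable_def by blast
  have "d_z f z = d_z Q z" "d_zbar f z = d_zbar Q z"
    using wirtinger_cong[of "ball 0 1" z f Q, OF open_ball z fQ Q] by simp_all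
  then have dz: "d_z f z = (1 / (2 * pi)) * ?I (\<lambda>t. fstar (cis t) * poisson_kernel_z \<alpha> z t)"
    and dzb: "d_zbar f z = (1 / (2 * pi)) * ?I (\<lambda>t. fstar (cis t) * poisson_kernel_zbar \<alpha> z t)"
    using wirtinger_eqI[OF Q'] by simp_all
  have sec: "continuous_on {0..2 * pi} (\<lambda>t. k z t)"
    if "continuous_on (ball 0 1 \<times> UNIV) (\<lambda>(z, t). k z t)" for k :: "complex \<Rightarrow> real \<Rightarrow> complex"
  proof -
    have "continuous_on {0..2 * pi} (\<lambda>t. (z, t))" by (intro continuous_intros)
    from continuous_on_compose2[OF that this] show ?thesis using z by (simp add: image_subset_iff)
  qed
  note cz = sec[OF continuous_on_poisson_kernel(2)] and czb = sec[OF continuous_on_poisson_kernel(3)]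
  note fc = continuous_on_circle[OF fstar]
  have norm_I: "cmod (?I (\<lambda>t. fstar (cis t) * k t)) \<le> ?I (\<lambda>t. ?M * cmod (k t))"
    if "continuous_on {0..2 * pi} k" for k
  proof (rule integral_norm_bound_integral)
    show "cmod (fstar (cis t) * k t) \<le> ?M * cmod (k t)" if "t \<in> {0..2 * pi}" for t
      using cmod_le_circle_norm_inf[OF fstar that] by (simp add: norm_mult mult_right_mono)
  qed (use that in \<open>auto intro!: integrable_continuous_real continuous_intros fc\<close>)
  have M: "?M \<ge> 0"
    using order_trans[OF norm_ge_zero cmod_le_circle_norm_inf[OF fstar, of 0]] by simp
  have "2 * pi * D_norm f z = cmod (?I (\<lambda>t. fstar (cis t) * poisson_kernel_z \<alpha> z t)) +
      cmod (?I (\<lambda>t. fstar (cis t) * poisson_kernel_zbar \<alpha> z t))"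
    unfolding D_norm_def dz dzb by (simp add: norm_mult norm_divide field_simps)
  also have "\<dots> \<le> ?I (\<lambda>t. ?M * cmod (poisson_kernel_z \<alpha> z t)) + ?I (\<lambda>t. ?M * cmod (poisson_kernel_zbar \<alpha> z t))"
    by (intro add_mono norm_I cz czb)
  also have "\<dots> = ?I (\<lambda>t. ?M * cmod (poisson_kernel_z \<alpha> z t) + ?M * cmod (poisson_kernel_zbar \<alpha> z t))"
    by (intro Henstock_Kurzweil_Integration.integral_add[symmetric] integrable_continuous_real continuous_on_mult
        continuous_on_const continuous_on_norm cz czb)
  also have "\<dots> \<le> ?M * ?C / x * (2 * pi * ?F)"
  proof (rule integral_le[THEN order_trans])
    have zc: "cmod (cnj z) < 1" using z by simp
    have int: "((\<lambda>t. ?M * ?C / x * (x powr (\<alpha> + 1) * cmod (1 - cnj z * cis t) powr (- \<alpha> - 2))) has_integral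
        ?M * ?C / x * (2 * pi * ?F)) {0..2 * pi}"
      using has_integral_mult_right[OF integral_weight_cmod_powr[OF zc, of \<alpha>], of "?M * ?C / x"]
      by (simp add: x_def)
    then show "(\<lambda>t. ?M * ?C / x * (x powr (\<alpha> + 1) * cmod (1 - cnj z * cis t) powr (- \<alpha> - 2))) integrable_on {0..2 * pi}"
      by blast
    show "?I (\<lambda>t. ?M * ?C / x * (x powr (\<alpha> + 1) * cmod (1 - cnj z * cis t) powr (- \<alpha> - 2))) \<le> ?M * ?C / x * (2 * pi * ?F)"
      by (simp only: integral_unique[OF int] order_refl)
    show "(\<lambda>t. ?M * cmod (poisson_kernel_z \<alpha> z t) + ?M * cmod (poisson_kernel_zbar \<alpha> z t)) integrable_on {0..2 * pi}"
      by (intro integrable_continuous_real continuous_on_add continuous_on_mult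
        continuous_on_const continuous_on_norm cz czb)
  next
    fix t
    have "?M * (cmod (poisson_kernel_z \<alpha> z t) + cmod (poisson_kernel_zbar \<alpha> z t)) \<le>
        ?M * (?C * (x powr \<alpha> * cmod (1 - cnj z * cis t) powr (- \<alpha> - 2)))"
      using poisson_kernel_derivatives_bound[OF \<alpha> z, of t] M unfolding x_def by (rule mult_left_mono)
    \<comment> \<open>The mean was evaluated with the weight to the power
      \<open>\<alpha> + 1\<close>; raising the exponent by one produces the factor
      \<open>1 / (1 - |z|^2)\<close> of the estimate.\<close>
    also have "\<dots> = ?M * ?C / x * (x powr (\<alpha> + 1) * cmod (1 - cnj z * cis t) powr (- \<alpha> - 2))"
      using x by (simp add: powr_add)
    finally show "?M * cmod (poisson_kernel_z \<alpha> z t) + ?M * cmod (poisson_kernel_zbar \<alpha> z t) \<le>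
        ?M * ?C / x * (x powr (\<alpha> + 1) * cmod (1 - cnj z * cis t) powr (- \<alpha> - 2))"
      by (simp only: distrib_left)
  qed
  finally have "2 * pi * D_norm f z \<le> 2 * pi * (?C * ?M / x * ?F)"
    by (simp only: mult_ac times_divide_eq_left times_divide_eq_right)
  then show ?thesis
    unfolding x_def by (simp only: mult_le_cancel_left_pos pi_gt_zero zero_less_mult_iff zero_less_numeral simp_thms)
qed

theorem theorem2p4:
  fixes \<alpha> :: real and f fstar :: "complex \<Rightarrow> complex" and z :: complex
  assumes "\<alpha> > -1"
    and "continuous_on (sphere 0 1) fstar"
    and "alpha_harmonic \<alpha> f"
    and "distributional_boundary_values f fstar"
    and "z \<in> ball 0 1"
  shows "D_norm f z \<le>
    (if \<alpha> \<ge> 0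
     then 2 * (1 + \<alpha>) * circle_norm_inf fstar / (1 - (cmod z)\<^sup>2)
            * hypergeom_2F1 (- \<alpha> / 2) (- \<alpha> / 2) 1 ((cmod z)\<^sup>2)
     else 2 * circle_norm_inf fstar / (1 - (cmod z)\<^sup>2)
            * hypergeom_2F1 (- \<alpha> / 2) (- \<alpha> / 2) 1 ((cmod z)\<^sup>2))"
proof -
  \<comment> \<open>The case distinction is only the evaluation of the absolute value in one uniform
    constant.\<close>
  have "2 + \<alpha> + \<bar>\<alpha>\<bar> = (if \<alpha> \<ge> 0 then 2 * (1 + \<alpha>) else 2)"
    by simp
  then show ?thesis
    using D_norm_bound[OF assms] by (auto split: if_splits)
qed

end
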